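(* Let $n\ge 2$, let $K/\mathbb{Q}$ be a totally imaginary number field of degree $d\ge 4$, and let $l\in K[x_0,\dots,x_n]$ be a linear form whose $d$ Galois conjugates over $\mathbb{Q}$ are in general position. If the action of $\mathrm{Gal}(\overline{\mathbb{Q}}/\mathbb{Q})$ on $\mathrm{Hom}(K,\mathbb{C})$ is $2$-transitive, then $$f:=N_{K/\mathbb{Q}}(l)$$ is a form of degree $d$ with rational coefficients that is irreducible over $\mathbb{Q}$ and a sum of two squares (of polynomials) over $\mathbb{R}$, but not a sum of any number of squares (of polynomials) over $\mathbb{Q}$.
   Context: A form is a homogeneous polynomial. $\overline{\mathbb{Q}}$ is the algebraic closure of $\mathbb{Q}$ in $\mathbb{C}$; $\mathrm{Hom}(K,\mathbb{C})$ is the set of the $d$ field embeddings $K\to\mathbb{C}$ (all of which have image in $\overline{\mathbb{Q}}$), on which $\mathrm{Gal}(\overline{\mathbb{Q}}/\mathbb{Q})$ acts by composition. For $\varphi\in\mathrm{Hom}(K,\mathbb{C})$ let ${}^\varphi l$ be the linear form obtained by applying $\varphi$ to the coefficients of $l$. The $d$ Galois conjugates of $l$ are the forms ${}^\varphi l$, $\varphi\in\mathrm{Hom}(K,\mathbb{C})$, and $N_{K/\mathbb{Q}}(l)=\prod_{\varphi\in\mathrm{Hom}(K,\mathbb{C})}{}^\varphi l$. These conjugates are in general position if the intersection of any $r\le n+1$ of the $d$ hyperplanes ${}^\varphi l=0$ in $\mathbb{P}^n$ has codimension $r$ (the empty set being assigned codimension $n+1$). *)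

theory Defs
  imports "HOL-Analysis.Analysis" "HOL-Library.Poly_Mapping"
begin

text \<open>The polynomial ring over \<open>'a\<close> with one variable for each element of \<open>'n\<close>. For a finite type
  \<open>'n\<close> with $n + 1$ elements this is the ring of polynomials in $x_0, \dots, x_n$.\<close>

type_synonym ('n, 'a) mvpoly = "('n \<Rightarrow>\<^sub>0 nat) \<Rightarrow>\<^sub>0 'a"

definition monom_degree :: "('n \<Rightarrow>\<^sub>0 nat) \<Rightarrow> nat" where
  "monom_degree m = (\<Sum>i\<in>Poly_Mapping.keys m. Poly_Mapping.lookup m i)"

text \<open>As usual, the zero polynomial counts as a form of every degree.\<close>

definition form_of_degree :: "nat \<Rightarrow> ('n, 'a::zero) mvpoly \<Rightarrow> bool" where
  "form_of_degree d p \<longleftrightarrow> (\<forall>m\<in>Poly_Mapping.keys p. monom_degree m = d)"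

definition mveval :: "('n::finite, 'a::comm_semiring_1) mvpoly \<Rightarrow> 'a ^ 'n \<Rightarrow> 'a" where
  "mveval p x = (\<Sum>m\<in>Poly_Mapping.keys p. Poly_Mapping.lookup p m *
     (\<Prod>i\<in>UNIV. (x $ i) ^ Poly_Mapping.lookup m i))"

text \<open>The coefficientwise application of a map; \<^const>\<open>Poly_Mapping.map\<close> sends zero coefficients to
  zero whatever the map does, which is immaterial for the ring homomorphisms used below.\<close>

abbreviation map_coeffs :: "('a::zero \<Rightarrow> 'b::zero) \<Rightarrow> ('n, 'a) mvpoly \<Rightarrow> ('n, 'b) mvpoly" where
  "map_coeffs \<equiv> Poly_Mapping.map"

definition sum_of_squares :: "nat \<Rightarrow> 'a::comm_semiring_1 \<Rightarrow> bool" where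
  "sum_of_squares k p \<longleftrightarrow> (\<exists>h :: nat \<Rightarrow> 'a. p = (\<Sum>i<k. (h i)\<^sup>2))"

definition rat_scale :: "rat \<Rightarrow> 'k::field_char_0 \<Rightarrow> 'k" where
  "rat_scale r x = of_rat r * x"

interpretation rat_vs: vector_space "rat_scale :: rat \<Rightarrow> 'k::field_char_0 \<Rightarrow> 'k"
  by unfold_locales (simp_all add: rat_scale_def algebra_simps of_rat_add of_rat_mult)

definition number_field :: "'k::field_char_0 itself \<Rightarrow> bool" where
  "number_field _ \<longleftrightarrow> (\<exists>B :: 'k set. finite B \<and> rat_vs.span B = UNIV)"

definition number_field_degree :: "'k::field_char_0 itself \<Rightarrow> nat" where
  "number_field_degree _ = rat_vs.dim (UNIV :: 'k set)"

definition complex_embeddings :: "('k::field_char_0 \<Rightarrow> complex) set" where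
  "complex_embeddings = {\<phi>. \<phi> 1 = 1 \<and> (\<forall>x y. \<phi> (x + y) = \<phi> x + \<phi> y) \<and> (\<forall>x y. \<phi> (x * y) = \<phi> x * \<phi> y)}"

definition totally_imaginary :: "'k::field_char_0 itself \<Rightarrow> bool" where
  "totally_imaginary _ \<longleftrightarrow>
     (\<forall>\<phi> \<in> (complex_embeddings :: ('k \<Rightarrow> complex) set). \<not> range \<phi> \<subseteq> \<real>)"

definition Qbar :: "complex set" where
  "Qbar = {z. algebraic z}"

text \<open>Automorphisms of \<^const>\<open>Qbar\<close> are functions on \<^typ>\<open>complex\<close> normalised to \<^const>\<open>undefined\<close> outside
  \<^const>\<open>Qbar\<close>. All complex embeddings of a number field have image in \<^const>\<open>Qbar\<close>, so composing with
  such a function is meaningful.\<close>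

definition Gal_Qbar :: "(complex \<Rightarrow> complex) set" where
  "Gal_Qbar = {\<sigma> \<in> extensional Qbar. bij_betw \<sigma> Qbar Qbar \<and>
     (\<forall>x\<in>Qbar. \<forall>y\<in>Qbar. \<sigma> (x + y) = \<sigma> x + \<sigma> y) \<and>
     (\<forall>x\<in>Qbar. \<forall>y\<in>Qbar. \<sigma> (x * y) = \<sigma> x * \<sigma> y) \<and>
     (\<forall>r :: rat. \<sigma> (of_rat r) = of_rat r)}"

definition two_transitive :: "'g set \<Rightarrow> ('g \<Rightarrow> 'x \<Rightarrow> 'x) \<Rightarrow> 'x set \<Rightarrow> bool" where
  "two_transitive G act X \<longleftrightarrow>
     (\<forall>x\<in>X. \<forall>x'\<in>X. \<forall>y\<in>X. \<forall>y'\<in>X. x \<noteq> x' \<longrightarrow> y \<noteq> y' \<longrightarrow>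
        (\<exists>g\<in>G. act g x = y \<and> act g x' = y'))"

definition field_norm_form :: "('n, 'k::field_char_0) mvpoly \<Rightarrow> ('n, complex) mvpoly" where
  "field_norm_form l = (\<Prod>\<phi>\<in>complex_embeddings. map_coeffs \<phi> l)"

text \<open>A linear subspace of projective space is represented by the linear subspace \<open>V\<close> of the
  affine space above it: it is empty if \<open>V\<close> is zero, and otherwise has dimension one less
  than \<open>V\<close>. The ambient projective space has dimension \<open>CARD('n) - 1\<close>.\<close>

definition proj_codim :: "(complex ^ 'n) set \<Rightarrow> nat" where
  "proj_codim V = (if V = {0} then CARD('n) else (CARD('n) - 1) - (vec.dim V - 1))"

text \<open>The hyperplanes are taken as a family indexed by the embeddings, so coinciding conjugates are
  not in general position.\<close>

definition conjugates_in_general_position :: "('n::finite, 'k::field_char_0) mvpoly \<Rightarrow> bool" where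
  "conjugates_in_general_position l \<longleftrightarrow>
     (\<forall>S \<subseteq> complex_embeddings. finite S \<longrightarrow> card S \<le> CARD('n) \<longrightarrow>
        proj_codim {x :: complex ^ 'n. \<forall>\<phi>\<in>S. mveval (map_coeffs \<phi> l) x = 0} = card S)"

end

theory Submission
  imports Defs "HOL-Computational_Algebra.Fundamental_Theorem_Algebra"
begin

text \<open>
  Write \<open>L\<^sub>\<phi>\<close> for the conjugate of \<open>l\<close> under an embedding \<open>\<phi>\<close> of \<open>K\<close>, write \<open>H\<^sub>\<phi>\<close> for its
  zero set in \<open>\<complex>\<^sup>n\<^sup>+\<^sup>1\<close>, and let \<open>f\<close> be the product of all \<open>L\<^sub>\<phi>\<close>.

  Two squares: no embedding is real, so complex conjugation pairs the factors off. Choosing one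
  embedding from each pair gives \<open>G\<close> with \<open>f = G \<cdot> cnj G = (Re G)\<^sup>2 + (Im G)\<^sup>2\<close>.

  No sum of rational squares: suppose \<open>f = \<Sum> h\<^sub>i\<^sup>2\<close> with \<open>h\<^sub>i\<close> rational; then \<open>2 deg h\<^sub>i \<le> d\<close>. If
  \<open>\<psi> = cnj \<circ> \<phi>\<close>, the space \<open>H\<^sub>\<phi> \<inter> H\<^sub>\<psi>\<close> is spanned by real vectors. At those \<open>f\<close> is zero, hence so is
  every \<open>h\<^sub>i\<close>, and then \<open>h\<^sub>i\<close> is zero on all of \<open>H\<^sub>\<phi> \<inter> H\<^sub>\<psi>\<close>
  (\<open>squares_vanish_on_conjugate_plane\<close>). As \<open>h\<^sub>i\<close> is rational, the Galois group carries this to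
  every other pair of distinct embeddings (\<open>vanish_on_conjugate_pair\<close>); this is where
  2-transitivity enters. Inside \<open>H\<^sub>\<phi>\<close> the polynomial \<open>h\<^sub>i\<close> now vanishes on \<open>d - 1\<close> distinct
  hyperplanes, more than its degree allows, so it vanishes on \<open>H\<^sub>\<phi>\<close>
  (\<open>vanish_on_many_hyperplanes\<close>). The same argument in the whole space, with the \<open>d\<close> hyperplanes
  \<open>H\<^sub>\<phi>\<close>, gives \<open>h\<^sub>i = 0\<close>, whereas \<open>f \<noteq> 0\<close>.

  Irreducibility: if \<open>f = a b\<close> over the rationals, one of the factors, say \<open>a\<close>, vanishes on some
  \<open>H\<^sub>\<phi>\<close>. Points with coordinates in \<open>K\<close> are dense in this hyperplane, so \<open>a\<close> vanishes on every
  conjugate hyperplane (\<open>vanish_on_conjugate_hyperplane\<close>). On a general line \<open>a\<close> then has \<open>d\<close> zeros,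
  which leaves degree \<open>0\<close> for \<open>b\<close> (\<open>cofactor_const\<close>).

  The arithmetic of number fields that this needs is developed along the following lines. The
  \<open>\<rat>\<close>-linear maps \<open>K \<rightarrow> \<complex>\<close> form a complex vector space of dimension \<open>[K : \<rat>]\<close>, on which \<open>K\<close> acts by
  \<open>(x f) y = f (x y)\<close>. Minimal polynomials are separable, so the action is
  diagonalisable, and its joint eigenvectors are the multiples of the embeddings. Hence the
  embeddings form a basis, there are \<open>[K : \<rat>]\<close> of them, and the trace \<open>\<Sum>\<^sub>\<phi> \<phi> x\<close> is rational
  (\<open>embeddings_trace\<close>). So the power sums \<open>\<Sum>\<^sub>\<phi> L\<^sub>\<phi>\<^sup>k\<close> have rational coefficients, and by Newton's
  identities so does the product \<open>f\<close> (\<open>norm_form_rational\<close>).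
\<close>

section \<open>Evaluation and coefficientwise maps\<close>

lemma mvpoly_induct [case_names zero single add]:
  fixes p :: "('n, 'a::comm_monoid_add) mvpoly"
  assumes "P 0" and "\<And>m c. P (Poly_Mapping.single m c)"
    and "\<And>p q. P p \<Longrightarrow> P q \<Longrightarrow> P (p + q)"
  shows "P p"
proof (induction p rule: update_induct)
  case const
  show ?case using assms(1) by simp
next
  case (update p m c)
  have "Poly_Mapping.update m c p = p + Poly_Mapping.single m c"
    using update.hyps
    by (intro poly_mapping_eqI)
      (auto simp: lookup_update lookup_add lookup_single in_keys_iff when_def)
  then show ?case using assms update by simp
qed

definition eval_monom :: "('n::finite \<Rightarrow>\<^sub>0 nat) \<Rightarrow> 'a::comm_semiring_1 ^ 'n \<Rightarrow> 'a" where
  "eval_monom m x = (\<Prod>i\<in>UNIV. (x $ i) ^ Poly_Mapping.lookup m i)"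

lemma eval_monom_add: "eval_monom (m + m') x = eval_monom m x * eval_monom m' x"
  by (simp add: eval_monom_def lookup_add power_add prod.distrib)

lemma mveval_superset:
  assumes "finite S" "Poly_Mapping.keys p \<subseteq> S"
  shows "mveval p x = (\<Sum>m\<in>S. Poly_Mapping.lookup p m * eval_monom m x)"
  unfolding mveval_def eval_monom_def using assms
  by (intro sum.mono_neutral_left) (auto simp: in_keys_iff)

lemma mveval_zero [simp]: "mveval 0 x = 0"
  by (simp add: mveval_def)

lemma mveval_single: "mveval (Poly_Mapping.single m c) x = c * eval_monom m x"
  by (subst mveval_superset[of "{m}"]) auto

lemma mveval_add: "mveval (p + q) x = mveval p x + mveval q x"
proof -
  let ?S = "Poly_Mapping.keys p \<union> Poly_Mapping.keys q"
  have "mveval (p + q) x = (\<Sum>m\<in>?S. Poly_Mapping.lookup (p + q) m * eval_monom m x)"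
    using keys_add[of p q] by (intro mveval_superset) auto
  then show ?thesis
    by (simp add: mveval_superset[of ?S p] mveval_superset[of ?S q] lookup_add sum.distrib
        distrib_right)
qed

lemma mveval_mult: "mveval (p * q) x = mveval p x * mveval q x"
proof (induction p rule: mvpoly_induct)
  case (single m c)
  show ?case
  proof (induction q rule: mvpoly_induct)
    case (single m' c')
    show ?case
      by (simp add: mult_single mveval_single eval_monom_add mult.left_commute mult.assoc)
  qed (simp_all add: mveval_add distrib_left)
qed (simp_all add: mveval_add distrib_right)

lemma mveval_one [simp]: "mveval 1 x = 1"
  using mveval_single[of 0 1 x] by (simp add: eval_monom_def)

lemma mveval_power: "mveval (p ^ k) x = mveval p x ^ k"
  by (induction k) (simp_all add: mveval_mult)

lemma mveval_sum: "mveval (sum p I) x = (\<Sum>i\<in>I. mveval (p i) x)"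
  by (induction I rule: infinite_finite_induct) (simp_all add: mveval_add)

lemma mveval_prod: "mveval (prod p I) x = (\<Prod>i\<in>I. mveval (p i) x)"
  by (induction I rule: infinite_finite_induct) (simp_all add: mveval_mult)

locale ring_morphism =
  fixes f :: "'a::comm_semiring_1 \<Rightarrow> 'b::comm_semiring_1"
  assumes hom_zero [simp]: "f 0 = 0" and hom_one [simp]: "f 1 = 1"
    and hom_add: "f (x + y) = f x + f y" and hom_mult: "f (x * y) = f x * f y"
begin

lemma hom_power: "f (x ^ k) = f x ^ k"
  by (induction k) (simp_all add: hom_mult)

lemma hom_sum: "f (sum g I) = (\<Sum>i\<in>I. f (g i))"
  by (induction I rule: infinite_finite_induct) (simp_all add: hom_add)

lemma hom_prod: "f (prod g I) = (\<Prod>i\<in>I. f (g i))"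
  by (induction I rule: infinite_finite_induct) (simp_all add: hom_mult)

end

lemma lookup_map_coeffs:
  "f 0 = 0 \<Longrightarrow> Poly_Mapping.lookup (map_coeffs f p) m = f (Poly_Mapping.lookup p m)"
  by (auto simp: map.rep_eq when_def)

lemma map_coeffs_zero [simp]: "map_coeffs f 0 = 0"
  by (simp add: map_eq_zero_iff)

lemma map_coeffs_compose:
  "f 0 = 0 \<Longrightarrow> g 0 = 0 \<Longrightarrow> map_coeffs f (map_coeffs g p) = map_coeffs (f \<circ> g) p"
  by (rule poly_mapping_eqI) (simp add: lookup_map_coeffs)

lemma map_coeffs_add:
  assumes "f 0 = 0" and "\<And>x y. f (x + y) = f x + f y"
  shows "map_coeffs f (p + q) = map_coeffs f p + map_coeffs f q"
  by (rule poly_mapping_eqI) (simp add: lookup_map_coeffs lookup_add assms)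

context ring_morphism begin

lemma map_coeffs_mult: "map_coeffs f (p * q :: ('n, 'a) mvpoly) = map_coeffs f p * map_coeffs f q"
proof (induction p rule: mvpoly_induct)
  case zero
  show ?case by simp
next
  case (single m c)
  show ?case
  proof (induction q rule: mvpoly_induct)
    case zero
    show ?case by (simp add: map_eq_zero_iff)
  next
    case (add p q)
    then show ?case by (simp add: distrib_left map_coeffs_add hom_add)
  qed (simp add: mult_single hom_mult)
qed (simp add: distrib_right map_coeffs_add hom_add)

lemma ring_morphism_map_coeffs:
  "ring_morphism (map_coeffs f :: ('n, 'a) mvpoly \<Rightarrow> ('n, 'b) mvpoly)"
proof
  show "map_coeffs f (1 :: ('n, 'a) mvpoly) = 1"
    by (simp flip: single_one)
qed (simp_all add: map_coeffs_add hom_add map_coeffs_mult)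

lemma mveval_map_coeffs: "mveval (map_coeffs f p) (\<chi> i. f (x $ i)) = f (mveval p x)"
  by (induction p rule: mvpoly_induct)
    (simp_all add: mveval_add hom_add map_coeffs_add mveval_single hom_mult eval_monom_def
      hom_prod hom_power)

end

lemma base_digits_unique:
  fixes a b :: "nat \<Rightarrow> nat"
  assumes "(\<Sum>i<N. a i * B ^ i) = (\<Sum>i<N. b i * B ^ i)"
    and "\<And>i. i < N \<Longrightarrow> a i < B" and "\<And>i. i < N \<Longrightarrow> b i < B" and "i < N"
  shows "a i = b i"
  using assms
proof (induction N arbitrary: a b i)
  case 0
  then show ?case by simp
next
  case (Suc N)
  have split: "(\<Sum>i<Suc N. c i * B ^ i) = c 0 + B * (\<Sum>i<N. c (Suc i) * B ^ i)"
    for c :: "nat \<Rightarrow> nat"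
    by (subst sum.lessThan_Suc_shift) (simp add: sum_distrib_left ac_simps)
  have eq: "a 0 + B * (\<Sum>i<N. a (Suc i) * B ^ i) = b 0 + B * (\<Sum>i<N. b (Suc i) * B ^ i)"
    using Suc.prems(1) by (simp only: split)
  have lt: "a 0 < B" "b 0 < B"
    using Suc.prems by auto
  from arg_cong[OF eq, of "\<lambda>k. k mod B"] lt have 0: "a 0 = b 0"
    by simp
  with eq lt have "(\<Sum>i<N. a (Suc i) * B ^ i) = (\<Sum>i<N. b (Suc i) * B ^ i)"
    by auto
  from Suc.IH[OF this] Suc.prems have "a (Suc j) = b (Suc j)" if "j < N" for j
    using that by simp
  with 0 Suc.prems(4) show ?case
    by (cases i) auto
qed

text \<open>Kronecker's substitution \<open>x\<^sub>i = t ^ (B ^ i)\<close>, with \<open>B\<close> above all exponents, turns distinct monomials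
into distinct powers of \<open>t\<close>: the exponents are read off as digits in base \<open>B\<close>. What remains is a
polynomial in one variable with infinitely many zeros.\<close>
lemma mvpoly_eq_0I:
  fixes p :: "('n::finite, 'a::{idom, ring_char_0}) mvpoly"
  assumes vanish: "\<And>x. (\<forall>i. x $ i \<in> \<nat>) \<Longrightarrow> mveval p x = 0"
  shows "p = 0"
proof (rule poly_mapping_eqI)
  fix m0
  obtain idx :: "'n \<Rightarrow> nat" where "bij_betw idx UNIV {0..<CARD('n)}"
    using ex_bij_betw_finite_nat[OF finite, of "UNIV :: 'n set"] by auto
  then have idx: "bij_betw idx UNIV {..<CARD('n)}"
    by (simp add: atLeast0LessThan)
  let ?l = "Poly_Mapping.lookup"
  define B where "B = Suc (\<Sum>m\<in>Poly_Mapping.keys p. \<Sum>i\<in>UNIV. ?l m i)"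
  have B: "?l m i < B" if "m \<in> Poly_Mapping.keys p" for m i
  proof -
    have "?l m i \<le> (\<Sum>i\<in>UNIV. ?l m i)"
      by (rule member_le_sum) auto
    also have "\<dots> \<le> (\<Sum>m\<in>Poly_Mapping.keys p. \<Sum>i\<in>UNIV. ?l m i)"
      using that by (intro member_le_sum) auto
    finally show ?thesis by (simp add: B_def)
  qed
  define code where "code m = (\<Sum>i\<in>UNIV. ?l m i * B ^ idx i)" for m :: "'n \<Rightarrow>\<^sub>0 nat"
  have code_alt: "code m = (\<Sum>k<CARD('n). ?l m (inv_into UNIV idx k) * B ^ k)" for m
    unfolding code_def
    by (subst sum.reindex_bij_betw[OF idx, symmetric]) (simp add: bij_betw_imp_inj_on[OF idx])
  have inj: "inj_on code (Poly_Mapping.keys p)"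
  proof (rule inj_onI, rule poly_mapping_eqI)
    fix m m' i assume m: "m \<in> Poly_Mapping.keys p" "m' \<in> Poly_Mapping.keys p" "code m = code m'"
    have "?l m (inv_into UNIV idx (idx i)) = ?l m' (inv_into UNIV idx (idx i))"
    proof (rule base_digits_unique[where N = "CARD('n)" and B = B and i = "idx i" and
          a = "\<lambda>k. ?l m (inv_into UNIV idx k)" and b = "\<lambda>k. ?l m' (inv_into UNIV idx k)"])
      show "(\<Sum>k<CARD('n). ?l m (inv_into UNIV idx k) * B ^ k) =
          (\<Sum>k<CARD('n). ?l m' (inv_into UNIV idx k) * B ^ k)"
        using m(3) by (simp only: code_alt)
      show "idx i < CARD('n)"
        using idx by (auto simp: bij_betw_def)
    qed (simp_all add: B m)
    then show "?l m i = ?l m' i"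
      using idx by (simp add: bij_betw_def)
  qed
  define P where "P = (\<Sum>m\<in>Poly_Mapping.keys p. monom (?l p m) (code m))"
  have "poly P (of_nat t) = 0" for t :: nat
  proof -
    define x :: "'a ^ 'n" where "x = (\<chi> i. of_nat t ^ (B ^ idx i))"
    have "poly P (of_nat t) = mveval p x"
      unfolding P_def mveval_def poly_sum poly_monom
    proof (rule sum.cong[OF refl])
      fix m
      have "(of_nat t :: 'a) ^ (?l m i * B ^ idx i) = (x $ i) ^ ?l m i" for i
        by (simp add: x_def power_mult[symmetric] mult.commute)
      then show "?l p m * of_nat t ^ code m = ?l p m * (\<Prod>i\<in>UNIV. (x $ i) ^ ?l m i)"
        by (simp add: code_def power_sum)
    qed
    also have "\<dots> = 0"
    proof (rule vanish, rule allI)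
      fix i
      have "x $ i = of_nat (t ^ (B ^ idx i))" by (simp add: x_def)
      then show "x $ i \<in> \<nat>" by (metis of_nat_in_Nats)
    qed
    finally show ?thesis .
  qed
  then have "range (of_nat :: nat \<Rightarrow> 'a) \<subseteq> {z. poly P z = 0}"
    by auto
  moreover have "infinite (range (of_nat :: nat \<Rightarrow> 'a))"
    by (intro range_inj_infinite injI) simp
  ultimately have "infinite {z. poly P z = 0}"
    using finite_subset by blast
  then have "P = 0"
    using poly_roots_finite by blast
  show "?l p m0 = ?l 0 m0"
  proof (cases "m0 \<in> Poly_Mapping.keys p")
    case True
    have "0 = coeff P (code m0)"
      by (simp add: \<open>P = 0\<close>)
    also have "\<dots> = (\<Sum>m\<in>Poly_Mapping.keys p. if m = m0 then ?l p m else 0)"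
      unfolding P_def coeff_sum coeff_monom
    proof (rule sum.cong[OF refl])
      fix m assume "m \<in> Poly_Mapping.keys p"
      then show "(if code m = code m0 then ?l p m else 0) = (if m = m0 then ?l p m else 0)"
        using inj_onD[OF inj, of m m0] True by presburger
    qed
    also have "\<dots> = ?l p m0"
      using True by simp
    finally show ?thesis by simp
  qed (simp add: in_keys_iff)
qed

lemma monom_degree_alt: "monom_degree m = (\<Sum>i\<in>(UNIV::'n::finite set). Poly_Mapping.lookup m i)"
  unfolding monom_degree_def by (intro sum.mono_neutral_left) (auto simp: in_keys_iff)

lemma form_of_degree_mult:
  fixes p q :: "('n::finite, 'a::comm_semiring_1) mvpoly"
  assumes "form_of_degree a p" "form_of_degree b q"
  shows "form_of_degree (a + b) (p * q)"
  unfolding form_of_degree_def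
proof
  fix m assume "m \<in> Poly_Mapping.keys (p * q)"
  then obtain u v where "m = u + v" "u \<in> Poly_Mapping.keys p" "v \<in> Poly_Mapping.keys q"
    using keys_mult[of p q] by blast
  with assms show "monom_degree m = a + b"
    by (simp add: form_of_degree_def monom_degree_alt lookup_add sum.distrib)
qed

lemma form_of_degree_prod:
  fixes p :: "'i \<Rightarrow> ('n::finite, 'a::comm_semiring_1) mvpoly"
  assumes "finite I" "\<And>i. i \<in> I \<Longrightarrow> form_of_degree 1 (p i)"
  shows "form_of_degree (card I) (prod p I)"
  using assms
proof (induction I rule: finite_induct)
  case empty
  show ?case by (auto simp: form_of_degree_def monom_degree_def)
next
  case (insert i I)
  then show ?case
    using form_of_degree_mult[of 1 "p i" "card I" "prod p I"] by simp
qed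

section \<open>Functions that are polynomial along lines\<close>

text \<open>Polynomial functions are only ever restricted to complex lines, so this is taken as the working
notion of a polynomial function of degree at most \<open>e\<close>. Unlike a statement about coefficients, it is
visibly stable under linear substitutions.\<close>
definition lines_degree_le :: "nat \<Rightarrow> (complex ^ 'n \<Rightarrow> complex) \<Rightarrow> bool" where
  "lines_degree_le e g \<longleftrightarrow> (\<forall>x y. \<exists>p. degree p \<le> e \<and> (\<forall>t. g (x + t *s y) = poly p t))"

lemma lines_degree_leE:
  assumes "lines_degree_le e g"
  obtains p where "degree p \<le> e" "\<And>t. g (x + t *s y) = poly p t"
  using assms unfolding lines_degree_le_def by blast

lemma lines_degree_le_diff:
  assumes "lines_degree_le a g" "lines_degree_le a h"
  shows "lines_degree_le a (\<lambda>x. g x - h x)"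
  unfolding lines_degree_le_def
proof (intro allI)
  fix x y
  obtain p where "degree p \<le> a" "\<And>t. g (x + t *s y) = poly p t"
    using lines_degree_leE[OF assms(1)] by metis
  moreover obtain q where "degree q \<le> a" "\<And>t. h (x + t *s y) = poly q t"
    using lines_degree_leE[OF assms(2)] by metis
  ultimately show "\<exists>p. degree p \<le> a \<and> (\<forall>t. g (x + t *s y) - h (x + t *s y) = poly p t)"
    by (intro exI[of _ "p - q"]) (auto intro: degree_diff_le)
qed

lemma lines_degree_le_linear:
  assumes "\<And>x y t. g (x + t *s y) = g x + t * g y"
  shows "lines_degree_le 1 g"
  unfolding lines_degree_le_def
proof (intro allI)
  fix x y
  show "\<exists>p. degree p \<le> 1 \<and> (\<forall>t. g (x + t *s y) = poly p t)"
    by (rule exI[of _ "[:g x, g y:]"]) (auto simp: assms)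
qed

lemma lines_degree_le_compose:
  assumes "lines_degree_le e g" and "\<And>x y t. L (x + t *s y) = L x + t *s L' y"
  shows "lines_degree_le e (\<lambda>x. g (L x))"
  unfolding lines_degree_le_def assms(2) using assms(1)[unfolded lines_degree_le_def] by blast

lemma lines_degree_le_const: "lines_degree_le e (\<lambda>_. c)"
  unfolding lines_degree_le_def by (intro allI exI[of _ "[:c:]"]) auto

lemma lines_degree_le_mveval:
  fixes h :: "('n::finite, complex) mvpoly"
  assumes "\<And>m. m \<in> Poly_Mapping.keys h \<Longrightarrow> monom_degree m \<le> e"
  shows "lines_degree_le e (mveval h)"
  unfolding lines_degree_le_def
proof (intro allI)
  fix x y :: "complex ^ 'n"
  define mp where "mp m = (\<Prod>i\<in>UNIV. [:x $ i, y $ i:] ^ Poly_Mapping.lookup m i)"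
    for m :: "'n \<Rightarrow>\<^sub>0 nat"
  define P where "P = (\<Sum>m\<in>Poly_Mapping.keys h. smult (Poly_Mapping.lookup h m) (mp m))"
  have "degree (mp m) \<le> monom_degree m" for m
  proof -
    have "degree (mp m) \<le> (\<Sum>i\<in>UNIV. degree ([:x $ i, y $ i:] ^ Poly_Mapping.lookup m i))"
      unfolding mp_def using degree_prod_sum_le[OF finite_class.finite_UNIV] by (auto simp: o_def)
    also have "\<dots> \<le> (\<Sum>i\<in>UNIV. Poly_Mapping.lookup m i)"
    proof (rule sum_mono)
      fix i
      have "degree ([:x $ i, y $ i:] ^ Poly_Mapping.lookup m i)
          \<le> degree [:x $ i, y $ i:] * Poly_Mapping.lookup m i"
        by (rule degree_power_le)
      also have "\<dots> \<le> 1 * Poly_Mapping.lookup m i"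
        by (rule mult_right_mono) auto
      finally show "degree ([:x $ i, y $ i:] ^ Poly_Mapping.lookup m i) \<le> Poly_Mapping.lookup m i"
        by simp
    qed
    finally show ?thesis by (simp add: monom_degree_alt)
  qed
  then have "degree P \<le> e"
    unfolding P_def
    by (intro degree_sum_le) (auto intro: order_trans[OF degree_smult_le] order_trans assms)
  moreover have "mveval h (x + t *s y) = poly P t" for t
    by (simp add: P_def mveval_def mp_def poly_sum poly_prod)
  ultimately show "\<exists>p. degree p \<le> e \<and> (\<forall>t. mveval h (x + t *s y) = poly p t)"
    by blast
qed

lemma lines_degree_le_mveval_ex: "\<exists>e. lines_degree_le e (mveval h)"
proof -
  have "lines_degree_le (\<Sum>m\<in>Poly_Mapping.keys h. monom_degree m) (mveval h)"
    by (rule lines_degree_le_mveval) (auto intro: member_le_sum)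
  then show ?thesis by blast
qed

text \<open>A linear subspace is irreducible. Along the line from a point where the first functions are nonzero
to a point where the next one is, every function of the family is a nonzero polynomial in the
parameter, so only finitely many parameters are bad.\<close>
lemma subspace_common_nonzero:
  assumes W: "vec.subspace W" and "finite I"
    and poly: "\<And>i. i \<in> I \<Longrightarrow> \<exists>e. lines_degree_le e (g i)"
    and nz: "\<And>i. i \<in> I \<Longrightarrow> \<exists>w\<in>W. g i w \<noteq> 0"
  shows "\<exists>w\<in>W. \<forall>i\<in>I. g i w \<noteq> 0"
  using assms(2-)
proof (induction I rule: finite_induct)
  case empty
  show ?case using vec.subspace_0[OF W] by blast
next
  case (insert j I)
  then obtain w z where w: "w \<in> W" "\<And>i. i \<in> I \<Longrightarrow> g i w \<noteq> 0" and z: "z \<in> W" "g j z \<noteq> 0"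
    by force
  have "\<forall>i\<in>insert j I. \<exists>p. \<forall>t. g i (w + t *s (z - w)) = poly p t"
    using insert.prems(1) by (meson lines_degree_leE)
  then obtain p where p: "g i (w + t *s (z - w)) = poly (p i) t" if "i \<in> insert j I" for i t
    by metis
  have "p i \<noteq> 0" if "i \<in> insert j I" for i
    using p[of i 0] p[of i 1] that w z by fastforce
  then have "finite (\<Union>i\<in>insert j I. {t. poly (p i) t = 0})"
    using insert.hyps(1) by (intro finite_UN_I) (auto intro: poly_roots_finite)
  then obtain t where "t \<notin> (\<Union>i\<in>insert j I. {t. poly (p i) t = 0})"
    using ex_new_if_finite[OF infinite_UNIV_char_0] by blast
  then have "\<forall>i\<in>insert j I. g i (w + t *s (z - w)) \<noteq> 0"
    using p by auto
  moreover have "w + t *s (z - w) \<in> W"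
    using W w(1) z(1) by (intro vec.subspace_add vec.subspace_scale vec.subspace_diff)
  ultimately show ?case by blast
qed

text \<open>The coordinates are freed one at a time: as a polynomial in a single coordinate, with the others
fixed, the function has all rational numbers as zeros.\<close>
lemma rational_points_dense:
  fixes g :: "complex ^ 'n::finite \<Rightarrow> complex"
  assumes g: "lines_degree_le e g" and "\<And>y. (\<forall>i. y $ i \<in> \<rat>) \<Longrightarrow> g y = 0"
  shows "g y = 0"
proof -
  have "\<forall>i. i \<notin> S \<longrightarrow> y $ i \<in> \<rat> \<Longrightarrow> g y = 0" for S y
    using finite[of S]
  proof (induction S arbitrary: y rule: finite_induct)
    case empty
    then show ?case using assms(2) by simp
  next
    case (insert j S)
    let ?z = "\<chi> i. if i = j then 0 else y $ i" and ?e = "\<chi> i. if i = j then 1 else 0"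
    obtain p where p: "\<And>t. g (?z + t *s ?e) = poly p t"
      using g[unfolded lines_degree_le_def, rule_format, of ?z ?e] by blast
    have "poly p t = 0" if "t \<in> \<rat>" for t
      using insert.prems that by (subst p[symmetric], intro insert.IH) auto
    then have "\<rat> \<subseteq> {t. poly p t = 0}"
      by blast
    then have "p = 0"
      using poly_roots_finite[of p] finite_subset Rats_infinite by blast
    have "y = ?z + (y $ j) *s ?e"
      by (simp add: vec_eq_iff)
    then show ?case
      using p[of "y $ j"] \<open>p = 0\<close> by simp
  qed
  from this[of UNIV] show ?thesis by simp
qed

section \<open>Rational polynomials annihilating an algebraic element\<close>

definition rpoly :: "rat poly \<Rightarrow> 'k::field_char_0 \<Rightarrow> 'k" where
  "rpoly p x = poly (map_poly of_rat p) x"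

lemma rpoly_0 [simp]: "rpoly 0 x = 0"
  by (simp add: rpoly_def)

lemma rpoly_pCons [simp]: "rpoly (pCons a p) x = of_rat a + x * rpoly p x"
  by (simp add: rpoly_def map_poly_pCons)

lemma rpoly_add: "rpoly (p + q) x = rpoly p x + rpoly q x"
  by (induction p q rule: poly_induct2) (simp_all add: of_rat_add algebra_simps)

lemma rpoly_smult: "rpoly (smult a p) x = of_rat a * rpoly p x"
  by (induction p) (simp_all add: of_rat_mult algebra_simps)

lemma rpoly_mult: "rpoly (p * q) x = rpoly p x * rpoly q x"
  by (induction p) (simp_all add: rpoly_add rpoly_smult algebra_simps)

lemma rpoly_altdef: "rpoly p x = (\<Sum>i\<le>degree p. of_rat (coeff p i) * x ^ i)"
  by (simp add: rpoly_def poly_altdef degree_map_poly coeff_map_poly)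

text \<open>The powers up to exponent \<open>card F\<close> are one more than the dimension allows, so they are linearly
dependent unless two of them coincide.\<close>
lemma annihilator_if_powers_in_span:
  fixes x :: "'k::field_char_0"
  assumes "finite F" and powers: "\<And>i. x ^ i \<in> rat_vs.span F"
  shows "\<exists>p. p \<noteq> 0 \<and> rpoly p x = 0"
proof (cases "inj_on (\<lambda>i. x ^ i) {..card F}")
  case False
  then obtain i j where "i \<noteq> j" "x ^ i = x ^ j"
    by (auto simp: inj_on_def)
  moreover have "rpoly (monom 1 k) x = x ^ k" for k
    by (simp add: rpoly_def map_poly_monom poly_monom)
  moreover have "monom 1 i \<noteq> (monom 1 j :: rat poly)"
    using \<open>i \<noteq> j\<close> by (metis degree_monom_eq zero_neq_one)
  ultimately show ?thesis
    using rpoly_add[of "monom 1 i - monom 1 j" "monom 1 j" x]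
    by (intro exI[of _ "monom 1 i - monom 1 j"]) auto
next
  case True
  let ?X = "(\<lambda>i. x ^ i) ` {..card F}"
  have "card ?X = Suc (card F)"
    using True by (simp add: card_image)
  then have "rat_vs.dependent ?X"
    using rat_vs.independent_span_bound[OF \<open>finite F\<close>, of ?X] powers by (metis Suc_n_not_le_n image_subsetI)
  then obtain u v where u: "v \<in> ?X" "u v \<noteq> 0" "(\<Sum>v\<in>?X. rat_scale (u v) v) = 0"
    by (subst (asm) rat_vs.dependent_finite) auto
  define p where "p = (\<Sum>i\<le>card F. monom (u (x ^ i)) i)"
  have coeff: "coeff p i = (if i \<le> card F then u (x ^ i) else 0)" for i
    by (auto simp: p_def coeff_sum)
  from u(1) obtain k where "k \<le> card F" "v = x ^ k" by auto
  with u(2) coeff[of k] have "p \<noteq> 0" by auto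
  have "degree p \<le> card F"
    by (rule degree_le) (simp add: coeff)
  then have "rpoly p x = (\<Sum>i\<le>card F. of_rat (coeff p i) * x ^ i)"
    unfolding rpoly_altdef by (intro sum.mono_neutral_left) (auto simp: coeff_eq_0)
  also have "\<dots> = (\<Sum>v\<in>?X. rat_scale (u v) v)"
    by (subst sum.reindex[OF True]) (simp add: rat_scale_def coeff)
  finally show ?thesis using u(3) \<open>p \<noteq> 0\<close> by auto
qed

lemma minimal_annihilator:
  assumes "\<exists>p. p \<noteq> 0 \<and> rpoly p x = 0"
  obtains p where "p \<noteq> 0" "rpoly p x = 0" "\<And>q. rpoly q x = 0 \<Longrightarrow> p dvd q"
proof -
  obtain p where p: "p \<noteq> 0 \<and> rpoly p x = 0"
    and min: "\<And>q. q \<noteq> 0 \<and> rpoly q x = 0 \<Longrightarrow> degree p \<le> degree q"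
    using ex_has_least_nat[of "\<lambda>p. p \<noteq> 0 \<and> rpoly p x = 0" _ degree] assms by metis
  have "p dvd q" if "rpoly q x = 0" for q
  proof -
    have "rpoly q x = rpoly p x * rpoly (q div p) x + rpoly (q mod p) x"
      by (simp flip: rpoly_mult rpoly_add)
    then have "rpoly (q mod p) x = 0"
      using that p by simp
    then have "q mod p = 0"
      using degree_mod_less[of p q] min[of "q mod p"] p by force
    then show ?thesis by (simp add: mod_eq_0_iff_dvd)
  qed
  with p show ?thesis using that by blast
qed

lemma degree_annihilator:
  assumes "p \<noteq> 0" "rpoly p x = 0"
  shows "degree p \<noteq> 0"
proof
  assume "degree p = 0"
  then obtain a where "p = [:a:]" by (rule degree_eq_zeroE)
  with assms show False by simp
qed

text \<open>The minimal polynomial \<open>p\<close> of \<open>x\<close> is separable. A common complex root of \<open>p\<close> and its derivative has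
a minimal polynomial \<open>g\<close> dividing both. Since \<open>x\<close> is a root of \<open>g\<close> or of \<open>p / g\<close>, minimality of
\<open>p\<close> rules out that \<open>g\<close> is a proper factor, and then \<open>p\<close> itself would divide its derivative.\<close>
lemma rsquarefree_annihilator:
  fixes x :: "'k::field_char_0"
  assumes "\<exists>p. p \<noteq> 0 \<and> rpoly p x = 0"
  obtains p where "p \<noteq> 0" "rpoly p x = 0" "rsquarefree (map_poly of_rat p :: complex poly)"
proof -
  obtain p where p: "p \<noteq> 0" "rpoly p x = 0" and min: "\<And>q. rpoly q x = 0 \<Longrightarrow> p dvd q"
    using minimal_annihilator[OF assms] by blast
  have False if r: "poly (map_poly of_rat p) r = 0" "poly (pderiv (map_poly of_rat p)) r = 0"
    for r :: complex
  proof -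
    have deriv: "pderiv (map_poly of_rat p) = map_poly of_rat (pderiv p)"
      by (rule poly_eqI) (simp add: coeff_pderiv coeff_map_poly of_rat_mult of_rat_add)
    have roots: "rpoly p r = 0" "rpoly (pderiv p) r = 0"
      using r unfolding deriv rpoly_def by auto
    then obtain g where g: "g \<noteq> 0" "rpoly g r = 0" "g dvd p" "g dvd pderiv p"
      using minimal_annihilator[of r] p(1) by metis
    then obtain h where h: "p = g * h" by blast
    with p(2) consider "rpoly g x = 0" | "rpoly h x = 0"
      by (auto simp: rpoly_mult)
    then show False
    proof cases
      case 1
      then have "p dvd pderiv p"
        using min g(4) dvd_trans by blast
      then show False
        using not_dvd_pderiv degree_annihilator[OF p] by blast
    next
      case 2
      then have "degree p \<le> degree h"
        using min h p(1) by (intro dvd_imp_degree_le) auto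
      then show False
        using h p(1) degree_annihilator[OF g(1,2)] by (auto simp: degree_mult_eq)
    qed
  qed
  then have "rsquarefree (map_poly of_rat p :: complex poly)"
    by (auto simp: rsquarefree_roots)
  with p show ?thesis using that by blast
qed

section \<open>The algebraic numbers form a ring\<close>

lemma algebraic_iff_rpoly: "z \<in> Qbar \<longleftrightarrow> (\<exists>p. p \<noteq> 0 \<and> rpoly p z = 0)"
proof
  assume "z \<in> Qbar"
  then obtain q where q: "\<And>i. coeff q i \<in> \<rat>" "q \<noteq> 0" "poly q z = 0"
    by (auto simp: Qbar_def algebraic_altdef)
  have inv0: "inv (of_rat :: rat \<Rightarrow> complex) 0 = 0"
    by (metis of_rat_0 inv_f_f inj_def of_rat_eq_iff)
  have "map_poly of_rat (map_poly (inv (of_rat :: rat \<Rightarrow> complex)) q) = q"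
    using q(1) by (intro poly_eqI) (simp add: coeff_map_poly inv0 f_inv_into_f Rats_def)
  with q show "\<exists>p. p \<noteq> 0 \<and> rpoly p z = 0"
    by (metis map_poly_0 rpoly_def)
next
  assume "\<exists>p. p \<noteq> 0 \<and> rpoly p z = 0"
  then obtain p where "p \<noteq> 0" "rpoly p z = 0" by blast
  then show "z \<in> Qbar"
    unfolding Qbar_def rpoly_def
    by (auto intro!: algebraicI'[of "map_poly of_rat p"] simp: coeff_map_poly map_poly_eq_0_iff)
qed

text \<open>Division by \<open>p\<close> reduces every power to the remainder.\<close>
lemma powers_in_finite_span:
  fixes x :: "'k::field_char_0"
  assumes "p \<noteq> 0" "rpoly p x = 0"
  shows "x ^ i \<in> rat_vs.span ((\<lambda>j. x ^ j) ` {..<degree p})"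
proof -
  let ?r = "monom 1 i mod p"
  have "x ^ i = rpoly (monom 1 i) x"
    by (simp add: rpoly_def map_poly_monom poly_monom)
  also have "\<dots> = rpoly p x * rpoly (monom 1 i div p) x + rpoly ?r x"
    by (simp flip: rpoly_mult rpoly_add)
  finally have "x ^ i = rpoly ?r x"
    using assms by simp
  moreover have "rpoly ?r x \<in> rat_vs.span ((\<lambda>j. x ^ j) ` {..<degree p})"
  proof (cases "?r = 0")
    case True
    then show ?thesis by (simp add: rat_vs.span_zero)
  next
    case False
    then have "degree ?r < degree p"
      using degree_mod_less[OF assms(1)] by blast
    then show ?thesis
      unfolding rpoly_altdef rat_scale_def[symmetric]
      by (intro rat_vs.span_sum rat_vs.span_scale rat_vs.span_base) auto
  qed
  ultimately show ?thesis by simp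
qed

lemma span_times:
  fixes u v :: "'k::field_char_0"
  assumes "u \<in> rat_vs.span A" "v \<in> rat_vs.span B"
  shows "u * v \<in> rat_vs.span ((\<lambda>(a, b). a * b) ` (A \<times> B))"
  using assms(1)
proof (induction u rule: rat_vs.span_induct_alt)
  case base
  show ?case by (simp add: rat_vs.span_zero)
next
  case (step c a u)
  have "a * v \<in> rat_vs.span ((\<lambda>(a, b). a * b) ` (A \<times> B))"
    using assms(2)
  proof (induction v rule: rat_vs.span_induct_alt)
    case base
    show ?case by (simp add: rat_vs.span_zero)
  next
    case (step c b v)
    have "a * b \<in> (\<lambda>(a, b). a * b) ` (A \<times> B)"
      using step(1) \<open>a \<in> A\<close> by force
    then have "rat_scale c (a * b) + a * v \<in> rat_vs.span ((\<lambda>(a, b). a * b) ` (A \<times> B))"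
      using step by (intro rat_vs.span_add[OF rat_vs.span_scale[OF rat_vs.span_base]])
    moreover have "rat_scale c (a * b) + a * v = a * (rat_scale c b + v)"
      by (simp add: rat_scale_def algebra_simps)
    ultimately show ?case by simp
  qed
  then have "rat_scale c (a * v) + u * v \<in> rat_vs.span ((\<lambda>(a, b). a * b) ` (A \<times> B))"
    using step by (intro rat_vs.span_add rat_vs.span_scale)
  moreover have "rat_scale c (a * v) + u * v = (rat_scale c a + u) * v"
    by (simp add: rat_scale_def algebra_simps)
  ultimately show ?case by simp
qed

text \<open>All powers of \<open>x + y\<close> and of \<open>x y\<close> lie in the finite-dimensional rational space spanned by the
products \<open>x\<^sup>i y\<^sup>j\<close> of bounded exponents.\<close>
lemma Qbar_add_mult:
  assumes "x \<in> Qbar" "y \<in> Qbar"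
  shows "x + y \<in> Qbar" and "x * y \<in> Qbar"
proof -
  obtain p q where p: "p \<noteq> 0" "rpoly p x = 0" and q: "q \<noteq> 0" "rpoly q y = 0"
    using assms by (auto simp: algebraic_iff_rpoly)
  define F where "F = (\<lambda>(a, b). a * b) `
    ((\<lambda>j. x ^ j) ` {..<degree p} \<times> (\<lambda>j. y ^ j) ` {..<degree q})"
  have F: "finite F" by (simp add: F_def)
  have prods: "x ^ i * y ^ j \<in> rat_vs.span F" for i j
    unfolding F_def by (intro span_times powers_in_finite_span p q)
  have "(x + y) ^ k \<in> rat_vs.span F" for k
  proof -
    have "(x + y) ^ k = (\<Sum>i\<le>k. rat_scale (of_nat (k choose i)) (x ^ i * y ^ (k - i)))"
      by (simp add: binomial_ring rat_scale_def ac_simps)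
    also have "\<dots> \<in> rat_vs.span F"
      by (intro rat_vs.span_sum rat_vs.span_scale prods)
    finally show ?thesis .
  qed
  moreover have "(x * y) ^ k \<in> rat_vs.span F" for k
    using prods by (simp add: power_mult_distrib)
  ultimately show "x + y \<in> Qbar" "x * y \<in> Qbar"
    unfolding algebraic_iff_rpoly using annihilator_if_powers_in_span[OF F] by blast+
qed

section \<open>Complex embeddings of a number field\<close>

lemma complex_embeddingsD:
  assumes "\<phi> \<in> complex_embeddings"
  shows "\<phi> 1 = 1" "\<phi> (x + y) = \<phi> x + \<phi> y" "\<phi> (x * y) = \<phi> x * \<phi> y" "\<phi> 0 = 0"
proof -
  show *: "\<phi> (x + y) = \<phi> x + \<phi> y" for x y
    using assms by (simp add: complex_embeddings_def)
  show "\<phi> 0 = 0"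
    using *[of 0 0] by simp
qed (use assms in \<open>simp_all add: complex_embeddings_def\<close>)

lemma ring_morphism_embedding: "\<phi> \<in> complex_embeddings \<Longrightarrow> ring_morphism \<phi>"
  by unfold_locales (simp_all add: complex_embeddingsD)

lemma ring_morphism_of_rat: "ring_morphism (of_rat :: rat \<Rightarrow> 'k::field_char_0)"
  by unfold_locales (simp_all add: of_rat_add of_rat_mult)

lemma embedding_minus:
  assumes "\<phi> \<in> complex_embeddings"
  shows "\<phi> (- x) = - \<phi> x"
  using complex_embeddingsD(2)[OF assms, of x "- x"] complex_embeddingsD(4)[OF assms]
  by (simp add: eq_neg_iff_add_eq_0 add.commute)

lemma embedding_eq_0_iff:
  assumes "\<phi> \<in> complex_embeddings"
  shows "\<phi> x = 0 \<longleftrightarrow> x = 0"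
proof
  assume "\<phi> x = 0"
  show "x = 0"
  proof (rule ccontr)
    assume "x \<noteq> 0"
    then have "\<phi> x * \<phi> (inverse x) = 1"
      using complex_embeddingsD[OF assms] by (metis right_inverse)
    with \<open>\<phi> x = 0\<close> show False by simp
  qed
qed (simp add: complex_embeddingsD(4)[OF assms])

lemma embedding_of_rat:
  assumes "\<phi> \<in> complex_embeddings"
  shows "\<phi> (of_rat r) = of_rat r"
proof -
  have nat: "\<phi> (of_nat n) = of_nat n" for n
    by (induction n) (simp_all add: complex_embeddingsD[OF assms])
  have int: "\<phi> (of_int i) = of_int i" for i
    by (cases i rule: int_cases2) (simp_all add: nat embedding_minus[OF assms])
  obtain a b where r: "r = Fract a b" "b > 0"
    by (cases r) auto
  have "\<phi> (of_rat r) * \<phi> (of_int b) = \<phi> (of_int a)"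
    using r by (subst complex_embeddingsD(3)[OF assms, symmetric]) (simp add: of_rat_rat)
  then show ?thesis
    using r by (simp add: int of_rat_rat field_simps)
qed

lemma embedding_rpoly:
  assumes "\<phi> \<in> complex_embeddings"
  shows "\<phi> (rpoly p x) = rpoly p (\<phi> x)"
  by (induction p) (simp_all add: complex_embeddingsD[OF assms] embedding_of_rat[OF assms])

lemma number_field_annihilator:
  fixes x :: "'k::field_char_0"
  assumes "number_field TYPE('k)"
  shows "\<exists>p. p \<noteq> 0 \<and> rpoly p x = 0"
  using assms annihilator_if_powers_in_span[of _ x] unfolding number_field_def by auto

lemma embedding_in_Qbar:
  fixes x :: "'k::field_char_0"
  assumes "number_field TYPE('k)" "\<phi> \<in> complex_embeddings"
  shows "\<phi> x \<in> Qbar"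
  unfolding algebraic_iff_rpoly
  using number_field_annihilator[OF assms(1), of x] embedding_rpoly[OF assms(2)]
    complex_embeddingsD(4)[OF assms(2)] by metis

definition Q_linear :: "('k::field_char_0 \<Rightarrow> complex) \<Rightarrow> bool" where
  "Q_linear f \<longleftrightarrow> (\<forall>x y. f (x + y) = f x + f y) \<and> (\<forall>r x. f (of_rat r * x) = of_rat r * f x)"

text \<open>This is \<open>(q(T) f) y\<close> for the operator \<open>(T f) y = f (x y)\<close>.\<close>
definition poly_act :: "'k \<Rightarrow> complex poly \<Rightarrow> ('k::field_char_0 \<Rightarrow> complex) \<Rightarrow> 'k \<Rightarrow> complex" where
  "poly_act x q f y = (\<Sum>i\<le>degree q. coeff q i * f (x ^ i * y))"

lemma poly_act_superset:
  assumes "degree q \<le> N"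
  shows "poly_act x q f y = (\<Sum>i\<le>N. coeff q i * f (x ^ i * y))"
  unfolding poly_act_def using assms
  by (intro sum.mono_neutral_left) (auto simp: coeff_eq_0)

lemma poly_act_linear_factor:
  "poly_act x ([:-\<kappa>, 1:] * q) f y = poly_act x q (\<lambda>y. f (x * y) - \<kappa> * f y) y"
proof -
  let ?N = "degree q"
  have "degree ([:-\<kappa>, 1:] * q) \<le> Suc ?N"
    using degree_mult_le[of "[:-\<kappa>, 1:]" q] by simp
  then have "poly_act x ([:-\<kappa>, 1:] * q) f y
      = (\<Sum>i\<le>Suc ?N. (coeff (pCons 0 q) i - \<kappa> * coeff q i) * f (x ^ i * y))"
    by (subst poly_act_superset) auto
  also have "\<dots> = (\<Sum>i\<le>Suc ?N. coeff (pCons 0 q) i * f (x ^ i * y))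
      - \<kappa> * (\<Sum>i\<le>Suc ?N. coeff q i * f (x ^ i * y))"
    by (simp only: left_diff_distrib sum_subtractf sum_distrib_left mult.assoc)
  also have "(\<Sum>i\<le>Suc ?N. coeff (pCons 0 q) i * f (x ^ i * y))
      = (\<Sum>i\<le>?N. coeff q i * f (x ^ Suc i * y))"
    by (subst sum.atMost_Suc_shift) simp
  also have "(\<Sum>i\<le>Suc ?N. coeff q i * f (x ^ i * y)) = (\<Sum>i\<le>?N. coeff q i * f (x ^ i * y))"
    by (simp add: coeff_eq_0)
  finally show ?thesis
    by (simp add: poly_act_def right_diff_distrib sum_subtractf sum_distrib_left ac_simps)
qed

text \<open>An operator annihilated by a polynomial with distinct roots is diagonalisable. In the induction
step \<open>g = (T - \<mu>) f\<close> is a sum of eigenvectors \<open>G \<kappa>\<close> with \<open>\<kappa> \<noteq> \<mu>\<close>, and dividing each of them by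
\<open>\<kappa> - \<mu>\<close> gives a preimage of \<open>g\<close> under \<open>T - \<mu>\<close>, which differs from \<open>f\<close> by an eigenvector for
\<open>\<mu>\<close>. The space \<open>W\<close> is arbitrary so that the eigenvectors inherit further
properties of \<open>f\<close>.\<close>
lemma eigen_decomposition:
  fixes x :: "'k::field_char_0" and W :: "('k \<Rightarrow> complex) set"
  assumes mult: "\<And>f. f \<in> W \<Longrightarrow> (\<lambda>y. f (x * y)) \<in> W"
    and add: "\<And>f g. f \<in> W \<Longrightarrow> g \<in> W \<Longrightarrow> (\<lambda>y. f y + g y) \<in> W"
    and scale: "\<And>f c. f \<in> W \<Longrightarrow> (\<lambda>y. c * f y) \<in> W"
    and "finite S" "f \<in> W" "\<And>y. poly_act x (\<Prod>\<kappa>\<in>S. [:-\<kappa>, 1:]) f y = 0"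
  shows "\<exists>G. (\<forall>\<kappa>\<in>S. G \<kappa> \<in> W \<and> (\<forall>y. G \<kappa> (x * y) = \<kappa> * G \<kappa> y)) \<and> (\<forall>y. f y = (\<Sum>\<kappa>\<in>S. G \<kappa> y))"
  using assms(4-)
proof (induction S arbitrary: f rule: finite_induct)
  case empty
  then show ?case by (simp add: poly_act_def)
next
  case (insert \<mu> S)
  define g where "g y = f (x * y) - \<mu> * f y" for y
  have "(\<lambda>y. f (x * y) + (- \<mu>) * f y) \<in> W"
    by (rule add[OF mult scale]) (rule insert.prems)+
  then have "g \<in> W"
    by (simp add: g_def[abs_def])
  moreover have "poly_act x (\<Prod>\<kappa>\<in>S. [:-\<kappa>, 1:]) g y = 0" for y
    using insert.prems(2)[of y]
    unfolding prod.insert[OF insert.hyps(1,2)] poly_act_linear_factor by (simp only: g_def[abs_def])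
  ultimately obtain G where G: "\<And>\<kappa>. \<kappa> \<in> S \<Longrightarrow> G \<kappa> \<in> W"
      "\<And>\<kappa> y. \<kappa> \<in> S \<Longrightarrow> G \<kappa> (x * y) = \<kappa> * G \<kappa> y" "\<And>y. g y = (\<Sum>\<kappa>\<in>S. G \<kappa> y)"
    using insert.IH by blast
  define H where "H \<kappa> y = 1 / (\<kappa> - \<mu>) * G \<kappa> y" for \<kappa> y
  define h where "h y = f y - (\<Sum>\<kappa>\<in>S. H \<kappa> y)" for y
  have H: "H \<kappa> \<in> W" if "\<kappa> \<in> S" for \<kappa>
    unfolding H_def[abs_def] using G(1)[OF that] by (rule scale)
  have "(\<lambda>y. \<Sum>\<kappa>\<in>T. H \<kappa> y) \<in> W" if "T \<subseteq> S" for T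
    using finite_subset[OF that insert.hyps(1)] that
  proof (induction T rule: finite_induct)
    case empty
    show ?case using scale[OF insert.prems(1), of 0] by simp
  next
    case (insert \<nu> T)
    then show ?case using add[OF H] by simp
  qed
  from scale[OF this[OF order_refl], of "-1"] add[OF insert.prems(1)]
  have "h \<in> W" by (fastforce simp: h_def[abs_def])
  have "h (x * y) = \<mu> * h y" for y
  proof -
    have "h (x * y) - \<mu> * h y = g y - (\<Sum>\<kappa>\<in>S. H \<kappa> (x * y) - \<mu> * H \<kappa> y)"
      by (simp add: h_def g_def sum_subtractf sum_distrib_left algebra_simps)
    also have "(\<Sum>\<kappa>\<in>S. H \<kappa> (x * y) - \<mu> * H \<kappa> y) = (\<Sum>\<kappa>\<in>S. G \<kappa> y)"
    proof (rule sum.cong[OF refl])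
      fix \<kappa> assume "\<kappa> \<in> S"
      then have "\<kappa> \<noteq> \<mu>" using insert.hyps(2) by auto
      define k where "k = 1 / (\<kappa> - \<mu>)"
      have "H \<kappa> (x * y) - \<mu> * H \<kappa> y = ((\<kappa> - \<mu>) * k) * G \<kappa> y"
        unfolding H_def G(2)[OF \<open>\<kappa> \<in> S\<close>] k_def[symmetric] by (simp add: algebra_simps)
      moreover have "(\<kappa> - \<mu>) * k = 1"
        using \<open>\<kappa> \<noteq> \<mu>\<close> by (simp add: k_def)
      ultimately show "H \<kappa> (x * y) - \<mu> * H \<kappa> y = G \<kappa> y" by simp
    qed
    finally show ?thesis using G(3) by simp
  qed
  moreover have "H \<kappa> (x * y) = \<kappa> * H \<kappa> y" if "\<kappa> \<in> S" for \<kappa> y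
    using G(2)[OF that, of y] by (simp add: H_def)
  moreover have "(\<Sum>\<kappa>\<in>S. (if \<kappa> = \<mu> then h else H \<kappa>) y) = (\<Sum>\<kappa>\<in>S. H \<kappa> y)" for y
    using insert.hyps by (intro sum.cong) auto
  ultimately show ?case
    using \<open>h \<in> W\<close> H insert.hyps
    by (intro exI[of _ "\<lambda>\<kappa>. if \<kappa> = \<mu> then h else H \<kappa>"]) (auto simp: h_def)
qed

text \<open>Simultaneous diagonalisation of the commuting operators \<open>f \<mapsto> f (x \<cdot>)\<close> for \<open>x \<in> X\<close>, stated
as an induction principle: a property closed under addition holds for all \<open>\<rat>\<close>-linear maps once it
holds for the joint eigenvectors.\<close>
lemma Q_linear_induct_eigenfunctions:
  fixes X :: "'k::field_char_0 set"
  assumes alg: "\<And>x::'k. \<exists>p. p \<noteq> 0 \<and> rpoly p x = 0"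
    and zero: "P (\<lambda>y. 0)" and add: "\<And>f g. P f \<Longrightarrow> P g \<Longrightarrow> P (\<lambda>y. f y + g y)"
    and "finite X"
    and "\<And>g. Q_linear g \<Longrightarrow> \<forall>x\<in>X. \<exists>\<kappa>. \<forall>y. g (x * y) = \<kappa> * g y \<Longrightarrow> P g"
    and "Q_linear f"
  shows "P f"
  using assms(4-)
proof (induction X rule: finite_induct)
  case empty
  then show ?case by simp
next
  case (insert x X)
  have "P g" if g: "Q_linear g" and eig: "\<forall>z\<in>X. \<exists>\<kappa>. \<forall>y. g (z * y) = \<kappa> * g y" for g
  proof -
    from eig obtain ev where ev: "\<And>z y. z \<in> X \<Longrightarrow> g (z * y) = ev z * g y" by metis
    \<comment> \<open>the joint eigenspace of \<open>g\<close> for the operators already treated, which commute with \<open>x\<close>\<close>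
    define W where "W = {h. Q_linear h \<and> (\<forall>z\<in>X. \<forall>y. h (z * y) = ev z * h y)}"
    obtain p where p: "p \<noteq> 0" "rpoly p x = 0" "rsquarefree (map_poly of_rat p :: complex poly)"
      using rsquarefree_annihilator[OF alg] by blast
    let ?q = "map_poly of_rat p :: complex poly"
    define S where "S = {z. poly ?q z = 0}"
    have "?q \<noteq> 0" using p(1) by (simp add: map_poly_eq_0_iff)
    then have "finite S" by (simp add: S_def poly_roots_finite)
    have "poly_act x (\<Prod>\<kappa>\<in>S. [:-\<kappa>, 1:]) g y = 0" for y
    proof -
      have Q: "?q = smult (lead_coeff ?q) (\<Prod>\<kappa>\<in>S. [:-\<kappa>, 1:])"
        unfolding S_def using complex_poly_decompose_rsquarefree[OF p(3)] by simp
      have g_sum: "g (\<Sum>i\<in>I. of_rat (r i) * u i) = (\<Sum>i\<in>I. of_rat (r i) * g (u i))"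
        if "finite I" for I :: "nat set" and r :: "nat \<Rightarrow> rat" and u
      proof -
        have "g 0 = 0" using g unfolding Q_linear_def by (metis add_cancel_right_right)
        with that show ?thesis
          using g by (induction I rule: finite_induct) (simp_all add: Q_linear_def)
      qed
      have "poly_act x ?q g y = g (rpoly p x * y)"
        unfolding rpoly_altdef sum_distrib_right mult.assoc
        by (subst g_sum) (simp_all add: poly_act_def degree_map_poly coeff_map_poly)
      also have "\<dots> = 0"
        using p(2) g_sum[of "{}"] by simp
      finally have "poly_act x ?q g y = 0" .
      moreover have "poly_act x (smult c r) g y = c * poly_act x r g y" for c r
        using poly_act_superset[OF degree_smult_le[of c r], of x g y]
        by (simp add: poly_act_def sum_distrib_left ac_simps)
      moreover have "poly_act x ?q g y =
          poly_act x (smult (lead_coeff ?q) (\<Prod>\<kappa>\<in>S. [:-\<kappa>, 1:])) g y"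
        by (rule arg_cong[OF Q])
      ultimately have "lead_coeff ?q * poly_act x (\<Prod>\<kappa>\<in>S. [:-\<kappa>, 1:]) g y = 0"
        by simp
      with \<open>?q \<noteq> 0\<close> show ?thesis by simp
    qed
    moreover have "g \<in> W" using g ev by (simp add: W_def)
    moreover have "(\<lambda>y. h (x * y)) \<in> W" if "h \<in> W" for h
    proof -
      have "h (x * (of_rat r * y)) = of_rat r * h (x * y)" for r y
        using that unfolding mult.left_commute[of x] by (simp add: W_def Q_linear_def)
      moreover have "h (x * (z * y)) = ev z * h (x * y)" if "z \<in> X" for z y
        using \<open>h \<in> W\<close> that unfolding mult.left_commute[of x] by (simp add: W_def)
      ultimately show ?thesis
        using that by (simp add: W_def Q_linear_def distrib_left)
    qed
    moreover have "(\<lambda>y. h y + k y) \<in> W" if "h \<in> W" "k \<in> W" for h k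
      using that by (simp add: W_def Q_linear_def distrib_left)
    moreover have "(\<lambda>y. c * h y) \<in> W" if "h \<in> W" for h c
      using that by (simp add: W_def Q_linear_def distrib_left)
    ultimately have "\<exists>G. (\<forall>\<kappa>\<in>S. G \<kappa> \<in> W \<and> (\<forall>y. G \<kappa> (x * y) = \<kappa> * G \<kappa> y)) \<and>
        (\<forall>y. g y = (\<Sum>\<kappa>\<in>S. G \<kappa> y))"
      using \<open>finite S\<close> by (intro eigen_decomposition)
    then obtain G where G: "\<And>\<kappa>. \<kappa> \<in> S \<Longrightarrow> G \<kappa> \<in> W"
        "\<And>\<kappa> y. \<kappa> \<in> S \<Longrightarrow> G \<kappa> (x * y) = \<kappa> * G \<kappa> y" "\<And>y. g y = (\<Sum>\<kappa>\<in>S. G \<kappa> y)"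
      by blast
    have PG: "P (G \<kappa>)" if "\<kappa> \<in> S" for \<kappa>
      using G(1,2)[OF that] by (intro insert.prems) (auto simp: W_def)
    have "P (\<lambda>y. \<Sum>\<kappa>\<in>T. G \<kappa> y)" if "T \<subseteq> S" for T
      using finite_subset[OF that \<open>finite S\<close>] that
      by (induction T rule: finite_induct) (simp_all add: zero add PG)
    from this[OF order_refl] show "P g"
      by (simp only: G(3)[symmetric])
  qed
  then show ?case using insert.IH insert.prems(2) by blast
qed

text \<open>A joint eigenvector \<open>g\<close> satisfies \<open>g (x y) = \<theta> x g y\<close>. Then \<open>\<theta>\<close> is additive and multiplicative,
and \<open>g x = g 1 \<theta> x\<close>, so nonzero joint eigenvectors are multiples of embeddings.\<close>
lemma Q_linear_in_embedding_span:
  fixes f :: "'k::field_char_0 \<Rightarrow> complex"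
  assumes K: "number_field TYPE('k)" and "Q_linear f"
  shows "\<exists>E c. finite E \<and> E \<subseteq> complex_embeddings \<and> (\<forall>x. f x = (\<Sum>\<phi>\<in>E. c \<phi> * \<phi> x))"
proof -
  define P :: "('k \<Rightarrow> complex) \<Rightarrow> bool" where "P f \<longleftrightarrow>
    (\<exists>E c. finite E \<and> E \<subseteq> complex_embeddings \<and> (\<forall>x. f x = (\<Sum>\<phi>\<in>E. c \<phi> * \<phi> x)))" for f
  obtain B :: "'k set" where B: "finite B" "rat_vs.span B = UNIV"
    using K unfolding number_field_def by blast
  have "P f"
  proof (rule Q_linear_induct_eigenfunctions[where X = B and P = P])
    fix x :: 'k show "\<exists>p. p \<noteq> 0 \<and> rpoly p x = 0"
      by (rule number_field_annihilator[OF K])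
  next
    show "P (\<lambda>y. 0)" unfolding P_def by (intro exI[of _ "{}"]) auto
  next
    fix f g assume "P f" "P g"
    then obtain E c E' c' where
        f: "finite E" "E \<subseteq> complex_embeddings" "\<And>x. f x = (\<Sum>\<phi>\<in>E. c \<phi> * \<phi> x)" and
        g: "finite E'" "E' \<subseteq> complex_embeddings" "\<And>x. g x = (\<Sum>\<phi>\<in>E'. c' \<phi> * \<phi> x)"
      unfolding P_def by blast
    let ?c = "\<lambda>\<phi>. (if \<phi> \<in> E then c \<phi> else 0) + (if \<phi> \<in> E' then c' \<phi> else 0)"
    have "f x = (\<Sum>\<phi>\<in>E \<union> E'. (if \<phi> \<in> E then c \<phi> else 0) * \<phi> x)" for x
      unfolding f(3) using f(1) g(1) by (intro sum.mono_neutral_cong_left) auto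
    moreover have "g x = (\<Sum>\<phi>\<in>E \<union> E'. (if \<phi> \<in> E' then c' \<phi> else 0) * \<phi> x)" for x
      unfolding g(3) using f(1) g(1) by (intro sum.mono_neutral_cong_left) auto
    ultimately have "\<forall>x. f x + g x = (\<Sum>\<phi>\<in>E \<union> E'. ?c \<phi> * \<phi> x)"
      by (simp only: distrib_right sum.distrib) blast
    then show "P (\<lambda>y. f y + g y)"
      unfolding P_def using f g by (intro exI[of _ "E \<union> E'"] exI[of _ ?c]) auto
  next
    fix g assume g: "Q_linear g" and eig: "\<forall>x\<in>B. \<exists>\<kappa>. \<forall>y. g (x * y) = \<kappa> * g y"
    have "\<exists>\<kappa>. \<forall>y. g (x * y) = \<kappa> * g y" for x
    proof -
      have "x \<in> rat_vs.span B" using B by simp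
      then show ?thesis
      proof (induction x rule: rat_vs.span_induct_alt)
        case base
        have "g 0 = 0" using g unfolding Q_linear_def by (metis add_cancel_right_right)
        then show ?case by (intro exI[of _ 0]) simp
      next
        case (step c b x)
        then obtain \<kappa> \<mu> where "\<And>y. g (b * y) = \<kappa> * g y" "\<And>y. g (x * y) = \<mu> * g y"
          using eig by blast
        then have "g ((rat_scale c b + x) * y) = (of_rat c * \<kappa> + \<mu>) * g y" for y
          using g by (simp add: Q_linear_def rat_scale_def distrib_right mult.assoc)
        then show ?case by blast
      qed
    qed
    then obtain \<theta> where \<theta>: "\<And>x y. g (x * y) = \<theta> x * g y" by metis
    show "P g"
    proof (cases "g 1 = 0")
      case True
      then have "\<forall>x. g x = 0" using \<theta>[of _ 1] by simp
      then show ?thesis unfolding P_def by (intro exI[of _ "{}"]) auto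
    next
      case False
      have g1: "g x = g 1 * \<theta> x" for x using \<theta>[of x 1] by simp
      have "\<theta> \<in> complex_embeddings"
        unfolding complex_embeddings_def
      proof (intro CollectI conjI allI)
        show "\<theta> 1 = 1" using \<theta>[of 1 1] False by simp
        show "\<theta> (x + y) = \<theta> x + \<theta> y" for x y
          using g g1[of "x + y"] g1[of x] g1[of y] False
          by (metis Q_linear_def distrib_left mult_left_cancel)
        show "\<theta> (x * y) = \<theta> x * \<theta> y" for x y
          using \<theta>[of x y] g1[of "x * y"] g1[of y] False
          by (metis mult.left_commute mult_left_cancel)
      qed
      then show ?thesis
        unfolding P_def
        by (intro exI[of _ "{\<theta>}"] exI[of _ "\<lambda>_. g 1"]) (simp add: g1[symmetric])
    qed
  qed (rule B(1) assms(2))+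
  then show ?thesis unfolding P_def .
qed

text \<open>Dedekind's independence of characters: if \<open>\<theta> a \<noteq> \<psi> a\<close>, replacing \<open>x\<close> by \<open>a x\<close> and subtracting
\<open>\<psi> a\<close> times the original relation eliminates \<open>\<psi>\<close> but keeps \<open>\<theta>\<close>.\<close>
lemma embeddings_independent:
  assumes "finite E" "E \<subseteq> complex_embeddings" "\<And>x. (\<Sum>\<phi>\<in>E. c \<phi> * \<phi> x) = 0" "\<phi> \<in> E"
  shows "c \<phi> = 0"
  using assms
proof (induction E arbitrary: c \<phi> rule: finite_induct)
  case empty
  then show ?case by simp
next
  case (insert \<psi> E)
  have *: "c \<theta> = 0" if "\<theta> \<in> E" for \<theta>
  proof -
    from that insert.hyps(2) have "\<theta> \<noteq> \<psi>" by blast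
    then obtain a where a: "\<theta> a \<noteq> \<psi> a" by blast
    have "(\<Sum>\<phi>\<in>E. (c \<phi> * (\<phi> a - \<psi> a)) * \<phi> x) = 0" for x
    proof -
      have "(\<Sum>\<phi>\<in>insert \<psi> E. (c \<phi> * (\<phi> a - \<psi> a)) * \<phi> x)
          = (\<Sum>\<phi>\<in>insert \<psi> E. c \<phi> * \<phi> (a * x)) - \<psi> a * (\<Sum>\<phi>\<in>insert \<psi> E. c \<phi> * \<phi> x)"
        unfolding sum_distrib_left sum_subtractf[symmetric]
      proof (rule sum.cong[OF refl])
        fix \<phi> assume "\<phi> \<in> insert \<psi> E"
        then have "\<phi> (a * x) = \<phi> a * \<phi> x"
          using insert.prems(1) complex_embeddingsD(3) by blast
        then show "c \<phi> * (\<phi> a - \<psi> a) * \<phi> x = c \<phi> * \<phi> (a * x) - \<psi> a * (c \<phi> * \<phi> x)"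
          by (simp only:) (simp add: algebra_simps)
      qed
      also have "\<dots> = 0"
        by (simp only: insert.prems(2)) simp
      finally show ?thesis
        unfolding sum.insert[OF insert.hyps(1,2)] by simp
    qed
    then have "c \<theta> * (\<theta> a - \<psi> a) = 0"
      by (rule insert.IH[rotated]) (use insert.prems(1) that in blast)+
    with a show ?thesis by simp
  qed
  have "(\<Sum>\<phi>\<in>E. c \<phi> * \<phi> 1) = 0"
    by (intro sum.neutral) (simp add: *)
  then have "c \<psi> = 0"
    using insert.prems(1) insert.prems(2)[of 1] complex_embeddingsD(1)[of \<psi>]
    unfolding sum.insert[OF insert.hyps(1,2)] by simp
  with * insert.prems(3) show ?case by auto
qed

text \<open>The coordinate functionals of a rational basis \<open>B\<close> and the embeddings are two bases of the space of
\<open>\<rat>\<close>-linear maps into \<open>\<complex>\<close>. The trace of multiplication by \<open>y\<close> on this space is \<open>\<Sum>\<^sub>\<phi> \<phi> y\<close> in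
the second basis and visibly rational in the first; \<open>y = 1\<close> counts the embeddings.\<close>
lemma embeddings_trace:
  assumes K: "number_field TYPE('k::field_char_0)"
  shows finite_embeddings: "finite (complex_embeddings :: ('k \<Rightarrow> complex) set)"
    and card_embeddings: "card (complex_embeddings :: ('k \<Rightarrow> complex) set) = number_field_degree TYPE('k)"
    and sum_embeddings_rational: "(\<Sum>\<phi>\<in>complex_embeddings. \<phi> (x :: 'k)) \<in> \<rat>"
proof -
  obtain B0 :: "'k set" where B0: "finite B0" "rat_vs.span B0 = UNIV"
    using K unfolding number_field_def by blast
  obtain B :: "'k set" where B: "rat_vs.independent B" "UNIV \<subseteq> rat_vs.span B"
      "card B = number_field_degree TYPE('k)"
    using rat_vs.basis_exists[of "UNIV :: 'k set"] unfolding number_field_degree_def by metis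
  have "finite B"
    using rat_vs.independent_span_bound[OF B0(1) B(1)] B0(2) by simp
  define rep where "rep x b = rat_vs.representation B x b" for x b
  have expand: "(\<Sum>b\<in>B. of_rat (rep x b) * b) = x" for x
    unfolding rep_def rat_scale_def[symmetric]
    using B \<open>finite B\<close> by (intro rat_vs.sum_representation_eq) auto
  have "Q_linear (\<lambda>x. of_rat (rep x b))" for b
  proof -
    have "rat_vs.representation B (x + y) = (\<lambda>b. rat_vs.representation B x b + rat_vs.representation B y b)"
      for x y using B by (intro rat_vs.representation_add) auto
    moreover have "rat_vs.representation B (rat_scale r x) = (\<lambda>b. r * rat_vs.representation B x b)"
      for r x using B by (intro rat_vs.representation_scale) auto
    ultimately show ?thesis
      by (simp add: Q_linear_def rep_def of_rat_add of_rat_mult flip: rat_scale_def)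
  qed
  from Q_linear_in_embedding_span[OF K this]
  obtain E c where E: "\<And>b. finite (E b)" "\<And>b. E b \<subseteq> complex_embeddings"
    and c: "\<And>b x. of_rat (rep x b) = (\<Sum>\<phi>\<in>E b. c b \<phi> * \<phi> x)"
    by metis
  define E0 where "E0 = (\<Union>b\<in>B. E b)"
  define C where "C b \<phi> = (if \<phi> \<in> E b then c b \<phi> else 0)" for b \<phi>
  have E0: "finite E0" "E0 \<subseteq> complex_embeddings"
    using E \<open>finite B\<close> by (auto simp: E0_def)
  have C: "of_rat (rep x b) = (\<Sum>\<phi>\<in>E0. C b \<phi> * \<phi> x)" if "b \<in> B" for b x
    unfolding c using that E0 by (intro sum.mono_neutral_cong_left) (auto simp: C_def E0_def)
  have in_span: "\<psi> x = (\<Sum>\<phi>\<in>E0. (\<Sum>b\<in>B. \<psi> b * C b \<phi>) * \<phi> x)"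
    if \<psi>: "\<psi> \<in> complex_embeddings" for \<psi> x
  proof -
    have "\<psi> x = \<psi> (\<Sum>b\<in>B. of_rat (rep x b) * b)"
      by (simp only: expand)
    also have "\<dots> = (\<Sum>b\<in>B. \<psi> (of_rat (rep x b)) * \<psi> b)"
      by (simp add: ring_morphism.hom_sum[OF ring_morphism_embedding[OF \<psi>]] complex_embeddingsD[OF \<psi>])
    also have "\<dots> = (\<Sum>b\<in>B. \<Sum>\<phi>\<in>E0. \<psi> b * C b \<phi> * \<phi> x)"
      by (intro sum.cong refl) (simp add: embedding_of_rat[OF \<psi>] C sum_distrib_left sum_distrib_right ac_simps)
    finally show ?thesis
      by (subst (asm) sum.swap) (simp add: sum_distrib_right)
  qed
  \<comment> \<open>Expanding \<open>\<psi>\<close> first in coordinate functionals and then in embeddings must give back \<open>\<psi>\<close>.\<close>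
  have orth: "(\<Sum>b\<in>B. \<psi> b * C b \<phi>) = (if \<phi> = \<psi> then 1 else 0)" and mem: "\<psi> \<in> E0"
    if \<psi>: "\<psi> \<in> complex_embeddings" "\<phi> \<in> insert \<psi> E0" for \<psi> \<phi>
  proof -
    let ?E = "insert \<psi> E0" and ?k = "\<lambda>\<phi>. if \<phi> \<in> E0 then \<Sum>b\<in>B. \<psi> b * C b \<phi> else 0"
    have *: "?k \<phi> - (if \<phi> = \<psi> then 1 else 0) = 0" if "\<phi> \<in> ?E" for \<phi>
    proof (rule embeddings_independent[of ?E "\<lambda>\<phi>. ?k \<phi> - (if \<phi> = \<psi> then 1 else 0)"])
      fix x
      have "(\<Sum>\<phi>\<in>?E. ?k \<phi> * \<phi> x) = (\<Sum>\<phi>\<in>E0. (\<Sum>b\<in>B. \<psi> b * C b \<phi>) * \<phi> x)"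
        using E0 by (intro sum.mono_neutral_cong_right) auto
      moreover have "(\<Sum>\<phi>\<in>?E. (if \<phi> = \<psi> then 1 else 0) * \<phi> x) = (\<Sum>\<phi>\<in>?E. if \<phi> = \<psi> then \<phi> x else 0)"
        by (rule sum.cong) auto
      ultimately show "(\<Sum>\<phi>\<in>?E. (?k \<phi> - (if \<phi> = \<psi> then 1 else 0)) * \<phi> x) = 0"
        using in_span[OF \<psi>(1), of x] E0
        by (simp only: left_diff_distrib sum_subtractf) simp
    qed (use E0 \<psi> that in auto)
    from *[of \<psi>] show "\<psi> \<in> E0" by (auto split: if_splits)
    with *[OF \<psi>(2)] \<psi>(2) show "(\<Sum>b\<in>B. \<psi> b * C b \<phi>) = (if \<phi> = \<psi> then 1 else 0)"
      by (auto split: if_splits)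
  qed
  have eq: "complex_embeddings = E0"
    using E0 mem by blast
  have trace: "(\<Sum>\<phi>\<in>complex_embeddings. \<phi> y) = (\<Sum>b\<in>B. of_rat (rep (y * b) b))" for y :: 'k
  proof -
    have "(\<Sum>b\<in>B. of_rat (rep (y * b) b)) = (\<Sum>b\<in>B. \<Sum>\<phi>\<in>E0. \<phi> y * (\<phi> b * C b \<phi>))"
    proof (intro sum.cong refl)
      fix b assume "b \<in> B"
      then show "of_rat (rep (y * b) b) = (\<Sum>\<phi>\<in>E0. \<phi> y * (\<phi> b * C b \<phi>))"
        unfolding C[OF \<open>b \<in> B\<close>] using E0(2)
        by (intro sum.cong) (auto simp: complex_embeddingsD(3)[OF subsetD])
    qed
    also have "\<dots> = (\<Sum>\<phi>\<in>E0. \<phi> y * (\<Sum>b\<in>B. \<phi> b * C b \<phi>))"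
      by (subst sum.swap) (simp add: sum_distrib_left)
    also have "\<dots> = (\<Sum>\<phi>\<in>E0. \<phi> y)"
      using E0(2) by (intro sum.cong refl) (auto simp: orth)
    finally show ?thesis by (simp add: eq)
  qed
  show "finite (complex_embeddings :: ('k \<Rightarrow> complex) set)"
    using E0 eq by simp
  show "(\<Sum>\<phi>\<in>complex_embeddings. \<phi> x) \<in> \<rat>"
    unfolding trace by (rule Rats_sum) simp
  have "rep b b = 1" if "b \<in> B" for b
    using rat_vs.representation_basis[OF B(1) that] by (simp add: rep_def)
  then have "of_nat (card (complex_embeddings :: ('k \<Rightarrow> complex) set)) = (of_nat (card B) :: complex)"
    using trace[of 1] by (simp add: complex_embeddingsD(1))
  then show "card (complex_embeddings :: ('k \<Rightarrow> complex) set) = number_field_degree TYPE('k)"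
    using B(3) by simp
qed

section \<open>Rationality of the norm form\<close>

lemma fps_linear_mult_geometric:
  fixes c :: "'a::comm_ring_1"
  shows "(1 - fps_const c * fps_X) * Abs_fps (\<lambda>k. c ^ Suc k) = fps_const c"
proof (rule fps_ext)
  fix n
  show "fps_nth ((1 - fps_const c * fps_X) * Abs_fps (\<lambda>k. c ^ Suc k)) n = fps_nth (fps_const c) n"
    by (cases n) (simp_all add: left_diff_distrib mult.assoc)
qed

text \<open>The logarithmic derivative of \<open>\<Prod> (1 - a\<^sub>i X)\<close>; comparing coefficients gives Newton's identities.\<close>
lemma fps_deriv_prod_linear:
  fixes a :: "'i \<Rightarrow> 'a::comm_ring_1"
  assumes "finite I"
  defines "P \<equiv> \<Prod>i\<in>I. 1 - fps_const (a i) * fps_X"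
  shows "fps_deriv P = - (P * Abs_fps (\<lambda>k. \<Sum>i\<in>I. a i ^ Suc k))"
  unfolding P_def using assms(1)
proof (induction I rule: finite_induct)
  case empty
  show ?case by (simp add: fps_zero_def[symmetric])
next
  case (insert j I)
  let ?P = "\<Prod>i\<in>I. 1 - fps_const (a i) * fps_X"
  let ?S = "Abs_fps (\<lambda>k. \<Sum>i\<in>I. a i ^ Suc k)" and ?A = "Abs_fps (\<lambda>k. a j ^ Suc k)"
  let ?l = "1 - fps_const (a j) * fps_X"
  have "fps_deriv ?l = - fps_const (a j)"
    by simp
  then have "fps_deriv (?l * ?P) = ?l * fps_deriv ?P + (- fps_const (a j)) * ?P"
    by (simp only: fps_deriv_mult)
  also have "\<dots> = ?l * (- (?P * ?S)) + (- (?l * ?A)) * ?P"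
    by (simp only: insert.IH fps_linear_mult_geometric)
  also have "\<dots> = - (?l * ?P * (?A + ?S))"
  proof -
    have "l * (- (P * S)) + (- (l * A)) * P = - (l * P * (A + S))" for l P S A :: "'a fps"
      by (simp add: algebra_simps)
    then show ?thesis .
  qed
  also have "?A + ?S = Abs_fps (\<lambda>k. \<Sum>i\<in>insert j I. a i ^ Suc k)"
    using insert.hyps by (intro fps_ext) simp
  finally show ?case
    using insert.hyps by simp
qed

lemma fps_prod_linear_nth:
  fixes a :: "'i \<Rightarrow> 'a::comm_ring_1"
  assumes "finite I"
  defines "P \<equiv> \<Prod>i\<in>I. 1 - fps_const (a i) * fps_X"
  shows "fps_nth P 0 = 1" and "fps_nth P (card I) = (-1) ^ card I * (\<Prod>i\<in>I. a i)"
proof -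
  have "fps_nth P 0 = 1 \<and> fps_nth P (card I) = (-1) ^ card I * (\<Prod>i\<in>I. a i) \<and> (\<forall>k>card I. fps_nth P k = 0)"
    unfolding P_def using assms(1)
  proof (induction I rule: finite_induct)
    case (insert j I)
    have "fps_nth ((1 - fps_const (a j) * fps_X) * Q) (Suc k) = fps_nth Q (Suc k) - a j * fps_nth Q k" for Q k
      by (simp add: left_diff_distrib mult.assoc)
    moreover have "fps_nth ((1 - fps_const (a j) * fps_X) * Q) 0 = fps_nth Q 0" for Q
      by (simp add: left_diff_distrib mult.assoc)
    moreover have "\<exists>k'. k = Suc k' \<and> card I < k'" if "Suc (card I) < k" for k
      using that by (cases k) auto
    ultimately show ?case
      using insert by (auto simp: algebra_simps)
  qed auto
  then show "fps_nth P 0 = 1" "fps_nth P (card I) = (-1) ^ card I * (\<Prod>i\<in>I. a i)" by auto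
qed

text \<open>Newton's identities express \<open>n + 1\<close> times a coefficient of \<open>\<Prod> (1 - a\<^sub>i X)\<close> through earlier
coefficients and power sums; the last coefficient is the product up to sign.\<close>
lemma prod_mem_if_power_sums_mem:
  fixes a :: "'i \<Rightarrow> 'a::comm_ring_1"
  assumes "finite I"
    and one: "1 \<in> R" and minus: "\<And>x. x \<in> R \<Longrightarrow> - x \<in> R"
    and add: "\<And>x y. x \<in> R \<Longrightarrow> y \<in> R \<Longrightarrow> x + y \<in> R"
    and mult: "\<And>x y. x \<in> R \<Longrightarrow> y \<in> R \<Longrightarrow> x * y \<in> R"
    and div: "\<And>n x. of_nat (Suc n) * x \<in> R \<Longrightarrow> x \<in> R"
    and power_sums: "\<And>k. (\<Sum>i\<in>I. a i ^ Suc k) \<in> R"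
  shows "(\<Prod>i\<in>I. a i) \<in> R"
proof -
  define P where "P = (\<Prod>i\<in>I. 1 - fps_const (a i) * fps_X)"
  have zero: "0 \<in> R"
    using add[OF one minus[OF one]] by simp
  have sum: "sum g J \<in> R" if "\<And>j. j \<in> J \<Longrightarrow> g j \<in> R" for g :: "nat \<Rightarrow> 'a" and J
    using that by (induction J rule: infinite_finite_induct) (simp_all add: zero add)
  have "fps_nth P n \<in> R" for n
  proof (induction n rule: less_induct)
    case (less n)
    show ?case
    proof (cases n)
      case 0
      then show ?thesis using fps_prod_linear_nth(1)[OF assms(1), of a] one by (simp add: P_def)
    next
      case (Suc k)
      have "of_nat (Suc k) * fps_nth P n = fps_nth (fps_deriv P) k"
        by (simp add: Suc)
      also have "\<dots> = - (\<Sum>i=0..k. fps_nth P i * (\<Sum>j\<in>I. a j ^ Suc (k - i)))"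
        unfolding P_def fps_deriv_prod_linear[OF assms(1)] by (simp add: fps_mult_nth)
      also have "\<dots> \<in> R"
        by (intro minus sum mult less.IH power_sums) (simp add: Suc)
      finally show ?thesis by (rule div)
    qed
  qed
  then have P: "(-1) ^ card I * (\<Prod>i\<in>I. a i) \<in> R"
    using fps_prod_linear_nth(2)[OF assms(1), of a] by (metis P_def)
  have "(-1) ^ k \<in> R" for k
    by (induction k) (auto intro: one minus)
  from mult[OF this P] have "((-1) ^ card I * (-1) ^ card I) * (\<Prod>i\<in>I. a i) \<in> R"
    by (simp only: mult.assoc)
  moreover have "(-1) ^ card I * (-1) ^ card I = (1 :: 'a)"
    by (simp add: power_mult_distrib[symmetric])
  ultimately show ?thesis by simp
qed

lemma range_map_coeffs_of_rat:
  fixes p :: "('n, 'k::field_char_0) mvpoly"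
  shows "p \<in> range (map_coeffs of_rat) \<longleftrightarrow> (\<forall>m. Poly_Mapping.lookup p m \<in> \<rat>)"
proof
  assume "p \<in> range (map_coeffs of_rat)"
  then show "\<forall>m. Poly_Mapping.lookup p m \<in> \<rat>"
    by (auto simp: lookup_map_coeffs)
next
  assume p: "\<forall>m. Poly_Mapping.lookup p m \<in> \<rat>"
  have inv0: "inv (of_rat :: rat \<Rightarrow> 'k) 0 = 0"
    by (metis of_rat_0 inv_f_f inj_def of_rat_eq_iff)
  have "map_coeffs of_rat (map_coeffs (inv of_rat) p) = p"
    using p inv0 by (intro poly_mapping_eqI) (simp add: lookup_map_coeffs f_inv_into_f Rats_def)
  then show "p \<in> range (map_coeffs of_rat)" by (metis rangeI)
qed

text \<open>The coefficients of \<open>\<Sum>\<^sub>\<phi> L\<^sub>\<phi>\<^sup>k\<close> are the traces of the coefficients of \<open>l\<^sup>k\<close>.\<close>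
lemma norm_form_rational:
  fixes l :: "('n, 'k::field_char_0) mvpoly"
  assumes K: "number_field TYPE('k)"
  shows "field_norm_form l \<in> range (map_coeffs of_rat)"
proof -
  interpret rat: ring_morphism "of_rat :: rat \<Rightarrow> complex"
    by (rule ring_morphism_of_rat)
  interpret hom: ring_morphism "map_coeffs of_rat :: ('n, rat) mvpoly \<Rightarrow> ('n, complex) mvpoly"
    by (rule rat.ring_morphism_map_coeffs)
  let ?R = "range (map_coeffs of_rat) :: ('n, complex) mvpoly set"
  have "(\<Prod>\<phi>\<in>complex_embeddings. map_coeffs \<phi> l) \<in> ?R"
  proof (rule prod_mem_if_power_sums_mem)
    show "finite (complex_embeddings :: ('k \<Rightarrow> complex) set)"
      by (rule finite_embeddings[OF K])
    show "1 \<in> ?R"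
      using hom.hom_one by (metis rangeI)
  next
    fix x assume "x \<in> ?R"
    then show "- x \<in> ?R" unfolding range_map_coeffs_of_rat by simp
  next
    fix x y assume "x \<in> ?R" "y \<in> ?R"
    then show "x + y \<in> ?R" "x * y \<in> ?R"
      by (auto simp flip: hom.hom_add hom.hom_mult)
  next
    fix n x assume x: "of_nat (Suc n) * x \<in> ?R"
    show "x \<in> ?R"
      unfolding range_map_coeffs_of_rat
    proof
      fix m
      have "Poly_Mapping.lookup (of_nat k * x) m = of_nat k * Poly_Mapping.lookup x m" for k
        by (induction k) (simp_all add: lookup_add distrib_right)
      then have "of_nat (Suc n) * Poly_Mapping.lookup x m \<in> \<rat>"
        using x unfolding range_map_coeffs_of_rat by metis
      then have "of_nat (Suc n) * Poly_Mapping.lookup x m / of_nat (Suc n) \<in> \<rat>"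
        by (intro Rats_divide) auto
      then show "Poly_Mapping.lookup x m \<in> \<rat>"
        by (metis nonzero_mult_div_cancel_left of_nat_eq_0_iff nat.simps(3))
    qed
  next
    fix k
    show "(\<Sum>\<phi>\<in>complex_embeddings. map_coeffs \<phi> l ^ Suc k) \<in> ?R"
      unfolding range_map_coeffs_of_rat
    proof
      fix m
      have "Poly_Mapping.lookup (\<Sum>\<phi>\<in>complex_embeddings. map_coeffs \<phi> l ^ Suc k) m
          = (\<Sum>\<phi>\<in>complex_embeddings. \<phi> (Poly_Mapping.lookup (l ^ Suc k) m))"
        unfolding lookup_sum
      proof (rule sum.cong[OF refl])
        fix \<phi> :: "'k \<Rightarrow> complex" assume "\<phi> \<in> complex_embeddings"
        then interpret \<phi>: ring_morphism \<phi> by (rule ring_morphism_embedding)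
        interpret hom: ring_morphism "map_coeffs \<phi> :: ('n, 'k) mvpoly \<Rightarrow> ('n, complex) mvpoly"
          by (rule \<phi>.ring_morphism_map_coeffs)
        show "Poly_Mapping.lookup (map_coeffs \<phi> l ^ Suc k) m = \<phi> (Poly_Mapping.lookup (l ^ Suc k) m)"
          unfolding hom.hom_power[symmetric] by (simp add: lookup_map_coeffs)
      qed
      then show "Poly_Mapping.lookup (\<Sum>\<phi>\<in>complex_embeddings. map_coeffs \<phi> l ^ Suc k) m \<in> \<rat>"
        by (simp only: sum_embeddings_rational[OF K])
    qed
  qed
  then show ?thesis by (simp add: field_norm_form_def)
qed

lemma form_of_degree_map_coeffs:
  assumes "form_of_degree d p" "f 0 = 0"
  shows "form_of_degree d (map_coeffs f p)"
  using assms unfolding form_of_degree_def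
  by (metis in_keys_iff lookup_map_coeffs)

lemma form_of_degree_map_coeffsD:
  assumes "form_of_degree d (map_coeffs f p)" "f 0 = 0" "\<And>x. f x = 0 \<Longrightarrow> x = 0"
  shows "form_of_degree d p"
  using assms unfolding form_of_degree_def
  by (metis in_keys_iff lookup_map_coeffs)

lemma norm_form_degree:
  fixes l :: "('n::finite, 'k::field_char_0) mvpoly"
  assumes "number_field TYPE('k)" "form_of_degree 1 l"
  shows "form_of_degree (number_field_degree TYPE('k)) (field_norm_form l)"
  unfolding field_norm_form_def card_embeddings[OF assms(1), symmetric]
  using finite_embeddings[OF assms(1)] assms(2)
  by (intro form_of_degree_prod form_of_degree_map_coeffs) (simp_all add: complex_embeddingsD)

section \<open>The norm form is a sum of two squares over the reals\<close>

lemma fixpoint_free_involution_half: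
  assumes "finite E" "\<And>x. x \<in> E \<Longrightarrow> \<tau> x \<in> E \<and> \<tau> (\<tau> x) = x \<and> \<tau> x \<noteq> x"
  shows "\<exists>H. H \<subseteq> E \<and> H \<inter> \<tau> ` H = {} \<and> H \<union> \<tau> ` H = E"
  using assms
proof (induction "card E" arbitrary: E rule: less_induct)
  case less
  show ?case
  proof (cases "E = {}")
    case False
    then obtain x where x: "x \<in> E" by blast
    let ?E = "E - {x, \<tau> x}"
    have "card ?E < card E"
      using x less.prems(1) by (intro psubset_card_mono) auto
    moreover have "\<tau> y \<in> ?E \<and> \<tau> (\<tau> y) = y \<and> \<tau> y \<noteq> y" if "y \<in> ?E" for y
      using that less.prems(2)[of y] less.prems(2)[OF x] by auto
    ultimately obtain H where H: "H \<subseteq> ?E" "H \<inter> \<tau> ` H = {}" "H \<union> \<tau> ` H = ?E"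
      using less.hyps[of ?E] less.prems(1) by (metis finite_Diff)
    have "x \<notin> \<tau> ` H" "\<tau> x \<notin> H"
      using H by auto
    moreover have "\<tau> x \<notin> \<tau> ` H"
      using H(3) by blast
    ultimately show ?thesis
      using H x less.prems(2)[OF x] by (intro exI[of _ "insert x H"]) auto
  qed auto
qed

text \<open>With \<open>G = a + \<i> b\<close> this is \<open>(a + \<i> b) (a - \<i> b) = a\<^sup>2 + b\<^sup>2\<close>.\<close>
lemma mult_cnj_eq_sum_of_squares:
  fixes G :: "('n, complex) mvpoly"
  shows "G * map_coeffs cnj G = (map_coeffs (\<lambda>x. complex_of_real (Re x)) G)\<^sup>2
    + (map_coeffs (\<lambda>x. complex_of_real (Im x)) G)\<^sup>2"
proof -
  let ?I = "Poly_Mapping.single 0 \<i> :: ('n, complex) mvpoly"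
  let ?a = "map_coeffs (\<lambda>x. complex_of_real (Re x)) G"
  let ?b = "map_coeffs (\<lambda>x. complex_of_real (Im x)) G"
  have lookup: "Poly_Mapping.lookup (?I * p) m = \<i> * Poly_Mapping.lookup p m" for p m
    by (subst mult_map_scale_conv_mult[symmetric]) (simp add: lookup_map_coeffs)
  have "G = ?a + ?I * ?b"
    by (rule poly_mapping_eqI) (simp add: lookup_map_coeffs lookup_add lookup complex_eq)
  moreover have "map_coeffs cnj G = ?a - ?I * ?b"
    by (rule poly_mapping_eqI)
      (simp add: lookup_map_coeffs lookup_minus lookup complex_eq_iff)
  ultimately have "G * map_coeffs cnj G = (?a + ?I * ?b) * (?a - ?I * ?b)" by simp
  also have "\<dots> = ?a\<^sup>2 - ?I * ?I * ?b\<^sup>2"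
    by (simp add: algebra_simps power2_eq_square)
  also have "?I * ?I = - 1"
    by (simp add: mult_single single_uminus flip: single_one)
  finally show ?thesis by simp
qed

lemma cnj_embedding:
  assumes "\<phi> \<in> complex_embeddings"
  shows "cnj \<circ> \<phi> \<in> complex_embeddings"
  using assms by (auto simp: complex_embeddings_def)

lemma cnj_embedding_neq:
  fixes \<phi> :: "'k::field_char_0 \<Rightarrow> complex"
  assumes "totally_imaginary TYPE('k)" "\<phi> \<in> complex_embeddings"
  shows "cnj \<circ> \<phi> \<noteq> \<phi>"
proof
  assume "cnj \<circ> \<phi> = \<phi>"
  then have "\<phi> x \<in> \<real>" for x
    by (metis Reals_cnj_iff comp_apply)
  with assms show False
    unfolding totally_imaginary_def by blast
qed

text \<open>Conjugation acts on the embeddings without fixed points, so the norm form is \<open>G\<close> times its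
conjugate, where \<open>G\<close> collects one conjugate of \<open>l\<close> from each pair.\<close>
lemma norm_form_sum_of_two_squares:
  fixes l :: "('n, 'k::field_char_0) mvpoly"
  assumes K: "number_field TYPE('k)" and imag: "totally_imaginary TYPE('k)"
    and f: "map_coeffs of_rat f = field_norm_form l"
  shows "sum_of_squares 2 (map_coeffs of_rat f :: ('n, real) mvpoly)"
proof -
  let ?E = "complex_embeddings :: ('k \<Rightarrow> complex) set" and ?\<tau> = "\<lambda>\<phi>. cnj \<circ> \<phi>"
  have "\<exists>H. H \<subseteq> ?E \<and> H \<inter> ?\<tau> ` H = {} \<and> H \<union> ?\<tau> ` H = ?E"
    using cnj_embedding_neq[OF imag]
    by (intro fixpoint_free_involution_half finite_embeddings[OF K] conjI cnj_embedding)
      (auto simp: fun_eq_iff)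
  then obtain H where H: "H \<subseteq> ?E" "H \<inter> ?\<tau> ` H = {}" "H \<union> ?\<tau> ` H = ?E" by blast
  have "finite H"
    using H(1) finite_embeddings[OF K] finite_subset by blast
  define G where "G = (\<Prod>\<phi>\<in>H. map_coeffs \<phi> l)"
  have cnj: "ring_morphism cnj" by unfold_locales auto
  have "inj_on ?\<tau> H"
    by (rule inj_onI) (auto simp: fun_eq_iff)
  have "field_norm_form l = G * (\<Prod>\<phi>\<in>?\<tau> ` H. map_coeffs \<phi> l)"
    unfolding field_norm_form_def G_def H(3)[symmetric]
    using \<open>finite H\<close> H(2) by (intro prod.union_disjoint) auto
  also have "(\<Prod>\<phi>\<in>?\<tau> ` H. map_coeffs \<phi> l) = map_coeffs cnj G"
    unfolding G_def ring_morphism.hom_prod[OF ring_morphism.ring_morphism_map_coeffs[OF cnj]]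
      prod.reindex[OF \<open>inj_on ?\<tau> H\<close>]
    using H(1) by (intro prod.cong) (auto simp: map_coeffs_compose complex_embeddingsD(4)[OF subsetD])
  also note mult_cnj_eq_sum_of_squares
  also have "map_coeffs (\<lambda>x. complex_of_real (Re x)) G = map_coeffs of_real (map_coeffs Re G)"
    by (simp add: map_coeffs_compose o_def)
  also have "map_coeffs (\<lambda>x. complex_of_real (Im x)) G = map_coeffs of_real (map_coeffs Im G)"
    by (simp add: map_coeffs_compose o_def)
  finally have eq: "field_norm_form l
      = (map_coeffs of_real (map_coeffs Re G))\<^sup>2 + (map_coeffs of_real (map_coeffs Im G))\<^sup>2" .
  have "ring_morphism complex_of_real" by unfold_locales auto
  then interpret R: ring_morphism "map_coeffs of_real :: ('n, real) mvpoly \<Rightarrow> ('n, complex) mvpoly"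
    by (rule ring_morphism.ring_morphism_map_coeffs)
  have "complex_of_real \<in> complex_embeddings"
    by (simp add: complex_embeddings_def)
  from embedding_of_rat[OF this]
  have "map_coeffs of_real (map_coeffs of_rat f :: ('n, real) mvpoly)
      = map_coeffs complex_of_real ((map_coeffs Re G)\<^sup>2 + (map_coeffs Im G)\<^sup>2)"
    using f eq by (simp add: map_coeffs_compose o_def R.hom_add R.hom_power)
  then have "(map_coeffs of_rat f :: ('n, real) mvpoly) = (map_coeffs Re G)\<^sup>2 + (map_coeffs Im G)\<^sup>2"
    unfolding poly_mapping_eq_iff fun_eq_iff by (simp add: lookup_map_coeffs)
  then show ?thesis
    unfolding sum_of_squares_def
    by (intro exI[of _ "\<lambda>i. if i = 0 then map_coeffs Re G else map_coeffs Im G"])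
      (simp add: numeral_2_eq_2)
qed

section \<open>Linear forms and their conjugates\<close>

text \<open>The pairing is bilinear, not Hermitian: \<open>dotp v\<close> is the linear form with coefficient vector \<open>v\<close>.\<close>
definition dotp :: "complex ^ 'n::finite \<Rightarrow> complex ^ 'n \<Rightarrow> complex" where
  "dotp v x = (\<Sum>i\<in>UNIV. v $ i * x $ i)"

lemma dotp_add: "dotp v (x + y) = dotp v x + dotp v y"
  and dotp_diff: "dotp v (x - y) = dotp v x - dotp v y"
  and dotp_scale: "dotp v (t *s x) = t * dotp v x"
  by (simp_all add: dotp_def distrib_left right_diff_distrib sum.distrib sum_subtractf
      sum_distrib_left mult.left_commute)

lemma dotp_zero [simp]: "dotp v 0 = 0"
  by (simp add: dotp_def)

lemma dotp_axis: "dotp v (axis i 1) = v $ i"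
  by (simp add: dotp_def axis_def if_distrib cong: if_cong)

lemma lines_degree_le_dotp: "lines_degree_le 1 (dotp v)"
  by (rule lines_degree_le_linear) (simp add: dotp_add dotp_scale)

lemma subspace_dotp: "vec.subspace {x. \<forall>v\<in>V. dotp v x = 0}"
  unfolding vec.subspace_def by (simp add: dotp_add dotp_scale)

lemma linear_form_monomials:
  fixes p :: "('n::finite, 'a::zero) mvpoly"
  assumes "form_of_degree 1 p"
  shows "Poly_Mapping.keys p \<subseteq> range (\<lambda>i. Poly_Mapping.single i 1)"
proof
  fix m assume "m \<in> Poly_Mapping.keys p"
  then have "(\<Sum>i\<in>UNIV. Poly_Mapping.lookup m i) = 1"
    using assms by (simp add: form_of_degree_def monom_degree_alt)
  then obtain i where i: "Poly_Mapping.lookup m i = 1" "\<And>j. j \<noteq> i \<Longrightarrow> Poly_Mapping.lookup m j = 0"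
    by (subst (asm) sum_eq_1_iff) auto
  then have "m = Poly_Mapping.single i 1"
    by (intro poly_mapping_eqI) (auto simp: lookup_single when_def)
  then show "m \<in> range (\<lambda>i. Poly_Mapping.single i 1)" by blast
qed

lemma mveval_linear_form:
  fixes p :: "('n::finite, 'a::comm_semiring_1) mvpoly"
  assumes "form_of_degree 1 p"
  shows "mveval p x = (\<Sum>i\<in>UNIV. Poly_Mapping.lookup p (Poly_Mapping.single i 1) * x $ i)"
proof -
  have inj: "inj (\<lambda>i::'n. Poly_Mapping.single i (1::nat))"
    by (rule injI) (metis keys_single singleton_inject zero_neq_one)
  have eval: "eval_monom (Poly_Mapping.single i 1) x = x $ i" for i
  proof -
    have "eval_monom (Poly_Mapping.single i 1) x = (\<Prod>j\<in>UNIV. if j = i then x $ j else 1)"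
      unfolding eval_monom_def by (rule prod.cong) (auto simp: lookup_single when_def)
    then show ?thesis by simp
  qed
  have "mveval p x = (\<Sum>m\<in>range (\<lambda>i. Poly_Mapping.single i 1). Poly_Mapping.lookup p m * eval_monom m x)"
    using linear_form_monomials[OF assms] by (intro mveval_superset) auto
  also have "\<dots> = (\<Sum>i\<in>UNIV. Poly_Mapping.lookup p (Poly_Mapping.single i 1) * x $ i)"
    by (subst sum.reindex[OF inj]) (simp add: eval del: One_nat_def)
  finally show ?thesis .
qed

definition conj_vec :: "('n::finite, 'k::field_char_0) mvpoly \<Rightarrow> ('k \<Rightarrow> complex) \<Rightarrow> complex ^ 'n" where
  "conj_vec l \<phi> = (\<chi> i. \<phi> (Poly_Mapping.lookup l (Poly_Mapping.single i 1)))"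

lemma mveval_conjugate:
  assumes "form_of_degree 1 l" "\<phi> \<in> complex_embeddings"
  shows "mveval (map_coeffs \<phi> l) x = dotp (conj_vec l \<phi>) x"
  using form_of_degree_map_coeffs[OF assms(1), of \<phi>] complex_embeddingsD(4)[OF assms(2)]
  by (simp add: mveval_linear_form dotp_def conj_vec_def lookup_map_coeffs
      complex_embeddingsD(4)[OF assms(2)])

text \<open>Adding \<open>\<theta>\<close> to \<open>S\<close> raises the codimension of the common zero set, so this set must shrink. All
consequences of general position used later are of this kind.\<close>
lemma general_position_separate:
  fixes l :: "('n::finite, 'k::field_char_0) mvpoly"
  assumes gp: "conjugates_in_general_position l" and l: "form_of_degree 1 l"
    and S: "finite S" "S \<subseteq> complex_embeddings" "card S < CARD('n)"
    and \<theta>: "\<theta> \<in> complex_embeddings" "\<theta> \<notin> S"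
  shows "\<exists>x. (\<forall>\<phi>\<in>S. dotp (conj_vec l \<phi>) x = 0) \<and> dotp (conj_vec l \<theta>) x \<noteq> 0"
proof (rule ccontr)
  assume *: "\<not> ?thesis"
  let ?V = "\<lambda>S. {x :: complex ^ 'n. \<forall>\<phi>\<in>S. mveval (map_coeffs \<phi> l) x = 0}"
  have "mveval (map_coeffs \<phi> l) x = dotp (conj_vec l \<phi>) x" if "\<phi> \<in> S" for \<phi> x
    using S(2) that mveval_conjugate[OF l] by blast
  then have "?V (insert \<theta> S) = ?V S"
    using * mveval_conjugate[OF l \<theta>(1)] by auto
  moreover have codim: "proj_codim (?V T) = card T"
    if "T \<subseteq> complex_embeddings" "finite T" "card T \<le> CARD('n)" for T
    using gp that unfolding conjugates_in_general_position_def by blast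
  have "proj_codim (?V S) = card S"
    using S by (intro codim) auto
  moreover have "proj_codim (?V (insert \<theta> S)) = card (insert \<theta> S)"
    using S \<theta> by (intro codim) auto
  ultimately show False
    using S(1) \<theta>(2) by simp
qed

section \<open>Polynomials vanishing on many hyperplanes\<close>

text \<open>The line through \<open>x\<close> in direction \<open>y\<close> meets the hyperplane of \<open>v i\<close> at the parameter
\<open>- (v\<^sub>i \<cdot> x) / (v\<^sub>i \<cdot> y)\<close>. Two parameters coincide only if a certain linear form in \<open>y\<close> vanishes,
and \<open>indep\<close> provides points of \<open>W\<close> where it does not, so a general \<open>y\<close> in \<open>W\<close> separates them all.
The auxiliary condition \<open>q y \<noteq> 0\<close> leaves room for one further requirement on the direction.\<close>
lemma line_meeting_hyperplanes:
  fixes v :: "'i \<Rightarrow> complex ^ 'n::finite"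
  assumes W: "vec.subspace W" and I: "finite I" "2 \<le> card I"
    and indep: "\<And>i j. i \<in> I \<Longrightarrow> j \<in> I \<Longrightarrow> i \<noteq> j \<Longrightarrow> \<exists>y\<in>W. dotp (v i) y = 0 \<and> dotp (v j) y \<noteq> 0"
    and x: "\<And>i. i \<in> I \<Longrightarrow> dotp (v i) x \<noteq> 0"
    and q: "lines_degree_le e q" "\<exists>y\<in>W. q y \<noteq> 0"
  obtains y where "y \<in> W" "\<And>i. i \<in> I \<Longrightarrow> dotp (v i) y \<noteq> 0"
    "inj_on (\<lambda>i. - dotp (v i) x / dotp (v i) y) I" "q y \<noteq> 0"
proof -
  define g where "g k = (case k of None \<Rightarrow> q | Some (i, j) \<Rightarrow>
      if i = j then dotp (v i) else (\<lambda>y. dotp (v i) y * dotp (v j) x - dotp (v j) y * dotp (v i) x))"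
    for k
  have "\<exists>y\<in>W. \<forall>k\<in>insert None (Some ` (I \<times> I)). g k y \<noteq> 0"
  proof (rule subspace_common_nonzero[OF W])
    fix k assume k: "k \<in> insert None (Some ` (I \<times> I))"
    have "lines_degree_le 1 (\<lambda>y. dotp (v i) y * dotp (v j) x - dotp (v j) y * dotp (v i) x)" for i j
      by (rule lines_degree_le_linear) (simp add: dotp_add dotp_scale algebra_simps)
    then have "lines_degree_le 1 (g (Some (i, j)))" for i j
      by (simp add: g_def lines_degree_le_dotp del: One_nat_def)
    then show "\<exists>e. lines_degree_le e (g k)"
      using q(1) by (cases k) (auto simp: g_def)
    show "\<exists>y\<in>W. g k y \<noteq> 0"
    proof (cases k)
      case None
      with q(2) show ?thesis by (simp add: g_def)
    next
      case (Some a)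
      then obtain i j where ij: "k = Some (i, j)" "i \<in> I" "j \<in> I"
        using k by auto
      show ?thesis
      proof (cases "i = j")
        case True
        \<comment> \<open>A second index is needed to see that the form of \<open>v i\<close> is not identically zero on \<open>W\<close>.\<close>
        obtain i' where "i' \<in> I" "i' \<noteq> i"
          using I(2) ij(2) by (metis card_le_Suc0_iff_eq I(1) not_less_eq_eq numeral_2_eq_2)
        with indep[of i' i] ij True show ?thesis by (auto simp: g_def)
      next
        case False
        obtain y where "y \<in> W" "dotp (v i) y = 0" "dotp (v j) y \<noteq> 0"
          using indep[OF ij(2,3) False] by blast
        with ij(1) False x[OF ij(2)] show ?thesis
          by (intro bexI[of _ y]) (simp_all add: g_def)
      qed
    qed
  qed (use I in auto)
  then obtain y where y: "y \<in> W" "\<And>k. k \<in> insert None (Some ` (I \<times> I)) \<Longrightarrow> g k y \<noteq> 0"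
    by blast
  have nz: "dotp (v i) y \<noteq> 0" if "i \<in> I" for i
    using y(2)[of "Some (i, i)"] that by (simp add: g_def)
  moreover have "inj_on (\<lambda>i. - dotp (v i) x / dotp (v i) y) I"
  proof (rule inj_onI, rule ccontr)
    fix i j assume ij: "i \<in> I" "j \<in> I" "i \<noteq> j"
      and eq: "- dotp (v i) x / dotp (v i) y = - dotp (v j) x / dotp (v j) y"
    have "dotp (v i) y * dotp (v j) x - dotp (v j) y * dotp (v i) x \<noteq> 0"
      using y(2)[of "Some (i, j)"] ij by (simp add: g_def)
    with eq nz[OF ij(1)] nz[OF ij(2)] show False
      by (simp add: frac_eq_eq algebra_simps)
  qed
  moreover have "q y \<noteq> 0"
    using y(2)[of None] by (simp add: g_def)
  ultimately show ?thesis using that y(1) by blast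
qed

text \<open>On a general line through \<open>x\<close> the function would be a polynomial with more zeros than its degree.\<close>
lemma vanish_on_many_hyperplanes:
  fixes v :: "'i \<Rightarrow> complex ^ 'n::finite"
  assumes W: "vec.subspace W" and I: "finite I" "2 \<le> card I"
    and indep: "\<And>i j. i \<in> I \<Longrightarrow> j \<in> I \<Longrightarrow> i \<noteq> j \<Longrightarrow> \<exists>y\<in>W. dotp (v i) y = 0 \<and> dotp (v j) y \<noteq> 0"
    and h: "lines_degree_le e h" "e < card I"
    and vanish: "\<And>i x. i \<in> I \<Longrightarrow> x \<in> W \<Longrightarrow> dotp (v i) x = 0 \<Longrightarrow> h x = 0"
    and x: "x \<in> W"
  shows "h x = 0"
proof (cases "\<exists>i\<in>I. dotp (v i) x = 0")
  case True
  with vanish x show ?thesis by blast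
next
  case False
  obtain y where y: "y \<in> W" "\<And>i. i \<in> I \<Longrightarrow> dotp (v i) y \<noteq> 0"
    "inj_on (\<lambda>i. - dotp (v i) x / dotp (v i) y) I"
    by (rule line_meeting_hyperplanes[OF W I, where v = v and x = x and e = 0 and q = "\<lambda>_. 1"])
      (use indep False x lines_degree_le_const in auto)
  let ?t = "\<lambda>i. - dotp (v i) x / dotp (v i) y"
  obtain p where p: "degree p \<le> e" "\<And>t. h (x + t *s y) = poly p t"
    using h(1)[unfolded lines_degree_le_def, rule_format, of x y] by blast
  have "poly p (?t i) = 0" if "i \<in> I" for i
    unfolding p(2)[symmetric] using that W x y(1,2)
    by (intro vanish[of i] vec.subspace_add vec.subspace_scale) (auto simp: dotp_add dotp_diff dotp_scale)
  then have "?t ` I \<subseteq> {t. poly p t = 0}" by blast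
  then have "card I \<le> card {t. poly p t = 0}" if "p \<noteq> 0"
    using card_mono[OF poly_roots_finite[OF that]] card_image[OF y(3)] by metis
  then have "p = 0"
    using p(1) h(2) card_poly_roots_bound[of p] by fastforce
  then show ?thesis using p(2)[of 0] by simp
qed

section \<open>Transport between conjugates\<close>

lemma mveval_of_rat_point:
  "mveval (map_coeffs of_rat a) (\<chi> i. of_rat (r $ i)) = (of_rat (mveval a r) :: 'k::field_char_0)"
  by (rule ring_morphism.mveval_map_coeffs[OF ring_morphism_of_rat])

lemma rational_vector:
  fixes y :: "complex ^ 'n"
  assumes "\<forall>i. y $ i \<in> \<rat>"
  obtains r where "y = (\<chi> i. of_rat (r i))"
proof -
  from assms have "\<forall>i. \<exists>r. y $ i = of_rat r" by (auto elim: Rats_cases)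
  then obtain r where "\<And>i. y $ i = of_rat (r i)" by metis
  then show ?thesis using that[of r] by (simp add: vec_eq_iff)
qed

text \<open>For a nonzero coordinate \<open>v\<^sub>j\<close> the linear map \<open>\<rho> v\<close> projects onto the hyperplane of \<open>v\<close>, up to a
scalar, and its entries are polynomials in \<open>v\<close>. At a rational \<open>y\<close> the values of \<open>a\<close> at
\<open>\<rho> (conj_vec l \<phi>) y\<close> are therefore the images under the various \<open>\<phi>\<close> of one element of \<open>K\<close>, and
embeddings are injective.\<close>
lemma vanish_on_conjugate_hyperplane:
  fixes l :: "('n::finite, 'k::field_char_0) mvpoly" and a :: "('n, rat) mvpoly"
  assumes emb: "\<phi> \<in> complex_embeddings" "\<psi> \<in> complex_embeddings"
    and nz: "conj_vec l \<phi> \<noteq> 0"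
    and vanish: "\<And>x. dotp (conj_vec l \<phi>) x = 0 \<Longrightarrow> mveval (map_coeffs of_rat a) x = 0"
    and x: "dotp (conj_vec l \<psi>) x = 0"
  shows "mveval (map_coeffs of_rat a) x = 0"
proof -
  let ?A = "mveval (map_coeffs of_rat a :: ('n, complex) mvpoly)"
  let ?c = "\<lambda>i. Poly_Mapping.lookup l (Poly_Mapping.single i 1)"
  obtain j where j: "?c j \<noteq> 0"
    using nz embedding_eq_0_iff[OF emb(1)] by (auto simp: conj_vec_def vec_eq_iff)
  define \<rho> where "\<rho> v y = v $ j *s y - dotp v y *s axis j 1" for v y :: "complex ^ 'n"
  have in_hyperplane: "dotp v (\<rho> v y) = 0" for v y
    by (simp add: \<rho>_def dotp_diff dotp_scale dotp_axis)
  obtain e where "lines_degree_le e ?A" using lines_degree_le_mveval_ex by blast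
  then have "lines_degree_le e (\<lambda>y. ?A (\<rho> (conj_vec l \<psi>) y))"
    by (rule lines_degree_le_compose[where L' = "\<rho> (conj_vec l \<psi>)"])
      (simp add: \<rho>_def dotp_add dotp_scale vec_eq_iff algebra_simps)
  then have zero: "?A (\<rho> (conj_vec l \<psi>) y) = 0" for y
  proof (rule rational_points_dense)
    fix y :: "complex ^ 'n" assume "\<forall>i. y $ i \<in> \<rat>"
    then obtain r where y: "y = (\<chi> i. of_rat (r i))" by (rule rational_vector)
    \<comment> \<open>the point of \<open>K\<^sup>n\<^sup>+\<^sup>1\<close> whose conjugates are the points \<open>\<rho> (conj_vec l \<theta>) y\<close>\<close>
    define z :: "'k ^ 'n" where "z = (\<chi> i. ?c j * of_rat (r i)
      - (\<Sum>i\<in>UNIV. ?c i * of_rat (r i)) * (if i = j then 1 else 0))"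
    have eval: "?A (\<rho> (conj_vec l \<theta>) y) = \<theta> (mveval (map_coeffs of_rat a) z)"
      if "\<theta> \<in> complex_embeddings" for \<theta>
    proof -
      interpret \<theta>: ring_morphism \<theta> by (rule ring_morphism_embedding[OF that])
      have minus: "\<theta> (u - w) = \<theta> u - \<theta> w" for u w
        using \<theta>.hom_add[of u "- w"] embedding_minus[OF that] by simp
      have "\<rho> (conj_vec l \<theta>) y = (\<chi> i. \<theta> (z $ i))"
        by (simp add: \<rho>_def y z_def conj_vec_def dotp_def vec_eq_iff axis_def minus \<theta>.hom_mult
            \<theta>.hom_sum embedding_of_rat[OF that])
      moreover have "map_coeffs \<theta> (map_coeffs of_rat a) = (map_coeffs of_rat a :: ('n, complex) mvpoly)"
        by (simp add: map_coeffs_compose o_def embedding_of_rat[OF that])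
      ultimately show ?thesis
        using \<theta>.mveval_map_coeffs[of "map_coeffs of_rat a" z] by simp
    qed
    have "\<phi> (mveval (map_coeffs of_rat a) z) = 0"
      unfolding eval[OF emb(1), symmetric] by (rule vanish[OF in_hyperplane])
    then show "?A (\<rho> (conj_vec l \<psi>) y) = 0"
      unfolding eval[OF emb(2)] embedding_eq_0_iff[OF emb(1)]
      by (simp add: complex_embeddingsD(4)[OF emb(2)])
  qed
  have "conj_vec l \<psi> $ j \<noteq> 0"
    using j embedding_eq_0_iff[OF emb(2)] by (simp add: conj_vec_def)
  then have "\<rho> (conj_vec l \<psi>) (inverse (conj_vec l \<psi> $ j) *s x) = x"
    using x by (simp add: \<rho>_def dotp_scale vec.scale_scale)
  with zero show ?thesis by metis
qed

text \<open>An automorphism of \<^const>\<open>Qbar\<close> respects sums and products only of arguments in \<^const>\<open>Qbar\<close>. Carrying the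
membership along with the value makes its compatibility with polynomial expressions a matter of
applying rules.\<close>
definition gal_rel :: "(complex \<Rightarrow> complex) \<Rightarrow> complex \<Rightarrow> complex \<Rightarrow> bool" where
  "gal_rel \<sigma> z z' \<longleftrightarrow> z \<in> Qbar \<and> \<sigma> z = z'"

context
  fixes \<sigma> :: "complex \<Rightarrow> complex"
  assumes \<sigma>: "\<sigma> \<in> Gal_Qbar"
begin

lemma gal_rel_add: "gal_rel \<sigma> x x' \<Longrightarrow> gal_rel \<sigma> y y' \<Longrightarrow> gal_rel \<sigma> (x + y) (x' + y')"
  and gal_rel_mult: "gal_rel \<sigma> x x' \<Longrightarrow> gal_rel \<sigma> y y' \<Longrightarrow> gal_rel \<sigma> (x * y) (x' * y')"
  using \<sigma> by (auto simp: gal_rel_def Gal_Qbar_def Qbar_add_mult)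

lemma gal_rel_of_rat: "gal_rel \<sigma> (of_rat r) (of_rat r)"
proof -
  have "of_rat r \<in> Qbar"
    unfolding algebraic_iff_rpoly by (intro exI[of _ "[:-r, 1:]"]) (simp add: of_rat_minus)
  then show ?thesis
    using \<sigma> by (simp add: gal_rel_def Gal_Qbar_def)
qed

lemma gal_rel_0: "gal_rel \<sigma> 0 0" and gal_rel_1: "gal_rel \<sigma> 1 1"
  using gal_rel_of_rat[of 0] gal_rel_of_rat[of 1] by simp_all

lemma gal_rel_diff: "gal_rel \<sigma> x x' \<Longrightarrow> gal_rel \<sigma> y y' \<Longrightarrow> gal_rel \<sigma> (x - y) (x' - y')"
  using gal_rel_add[of x x' "of_rat (-1) * y" "of_rat (-1) * y'"]
    gal_rel_mult[OF gal_rel_of_rat[of "-1"]] by (simp add: of_rat_minus)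

lemma gal_rel_sum: "(\<And>i. i \<in> I \<Longrightarrow> gal_rel \<sigma> (f i) (g i)) \<Longrightarrow> gal_rel \<sigma> (sum f I) (sum g I)"
  by (induction I rule: infinite_finite_induct) (simp_all add: gal_rel_0 gal_rel_add)

lemma gal_rel_prod: "(\<And>i. i \<in> I \<Longrightarrow> gal_rel \<sigma> (f i) (g i)) \<Longrightarrow> gal_rel \<sigma> (prod f I) (prod g I)"
  by (induction I rule: infinite_finite_induct) (simp_all add: gal_rel_1 gal_rel_mult)

lemma gal_rel_power: "gal_rel \<sigma> x x' \<Longrightarrow> gal_rel \<sigma> (x ^ k) (x' ^ k)"
  by (induction k) (simp_all add: gal_rel_1 gal_rel_mult)

lemma gal_rel_mveval:
  assumes "\<And>i. gal_rel \<sigma> (x $ i) (x' $ i)"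
  shows "gal_rel \<sigma> (mveval (map_coeffs of_rat a) x) (mveval (map_coeffs of_rat a) x')"
  unfolding mveval_def
  by (intro gal_rel_sum gal_rel_mult gal_rel_prod gal_rel_power assms)
    (simp add: lookup_map_coeffs gal_rel_of_rat)

end

text \<open>The codimension two analogue of \<open>vanish_on_conjugate_hyperplane\<close>. With \<open>\<Delta>\<close> a nonzero \<open>2 \<times> 2\<close>
minor of \<open>v\<close> and \<open>w\<close>, Cramer's rule gives a map \<open>\<rho> v w\<close> that sends every \<open>y\<close> to a common zero of the
two forms and multiplies common zeros by \<open>\<Delta>\<close>. Its entries are polynomials in \<open>v\<close> and \<open>w\<close>
with integer coefficients, so \<open>\<sigma>\<close> maps \<open>\<rho>\<close> for \<open>\<phi>\<close> and \<open>\<psi>\<close> to \<open>\<rho>\<close> for their images.\<close>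
lemma vanish_on_conjugate_pair:
  fixes l :: "('n::finite, 'k::field_char_0) mvpoly" and a :: "('n, rat) mvpoly"
  assumes K: "number_field TYPE('k)" and \<sigma>: "\<sigma> \<in> Gal_Qbar"
    and emb: "\<phi> \<in> complex_embeddings" "\<psi> \<in> complex_embeddings"
    and indep: "conj_vec l (\<sigma> \<circ> \<phi>) \<noteq> 0"
      "\<exists>y. dotp (conj_vec l (\<sigma> \<circ> \<phi>)) y = 0 \<and> dotp (conj_vec l (\<sigma> \<circ> \<psi>)) y \<noteq> 0"
    and vanish: "\<And>x. dotp (conj_vec l \<phi>) x = 0 \<Longrightarrow> dotp (conj_vec l \<psi>) x = 0 \<Longrightarrow>
      mveval (map_coeffs of_rat a) x = 0"
    and x: "dotp (conj_vec l (\<sigma> \<circ> \<phi>)) x = 0" "dotp (conj_vec l (\<sigma> \<circ> \<psi>)) x = 0"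
  shows "mveval (map_coeffs of_rat a) x = 0"
proof -
  let ?A = "mveval (map_coeffs of_rat a :: ('n, complex) mvpoly)"
  let ?v = "conj_vec l (\<sigma> \<circ> \<phi>)" and ?w = "conj_vec l (\<sigma> \<circ> \<psi>)"
  have "\<exists>i j. ?v $ i * ?w $ j - ?v $ j * ?w $ i \<noteq> 0"
  proof (rule ccontr)
    assume *: "\<not> ?thesis"
    obtain i where i: "?v $ i \<noteq> 0"
      using indep(1) by (auto simp: vec_eq_iff)
    obtain y where y: "dotp ?v y = 0" "dotp ?w y \<noteq> 0" using indep(2) by blast
    have "?v $ i * dotp ?w y = ?w $ i * dotp ?v y"
      unfolding dotp_def sum_distrib_left
    proof (rule sum.cong[OF refl])
      fix j
      have "?v $ i * ?w $ j = ?v $ j * ?w $ i" using * by auto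
      then show "?v $ i * (?w $ j * y $ j) = ?w $ i * (?v $ j * y $ j)"
        by (metis mult.assoc mult.commute)
    qed
    with i y show False by simp
  qed
  then obtain i j where ij: "?v $ i * ?w $ j - ?v $ j * ?w $ i \<noteq> 0" by blast
  define \<Delta> where "\<Delta> v w = v $ i * w $ j - v $ j * w $ i" for v w :: "complex ^ 'n"
  define \<rho> where "\<rho> v w y = \<Delta> v w *s y - (w $ j * dotp v y - v $ j * dotp w y) *s axis i 1
      - (v $ i * dotp w y - w $ i * dotp v y) *s axis j 1" for v w y :: "complex ^ 'n"
  have in_plane: "dotp v (\<rho> v w y) = 0" "dotp w (\<rho> v w y) = 0" for v w y
    unfolding \<rho>_def dotp_diff dotp_scale dotp_axis \<Delta>_def by algebra+
  obtain e where "lines_degree_le e ?A" using lines_degree_le_mveval_ex by blast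
  then have "lines_degree_le e (\<lambda>y. ?A (\<rho> ?v ?w y))"
    by (rule lines_degree_le_compose[where L' = "\<rho> ?v ?w"])
      (simp add: \<rho>_def dotp_add dotp_scale vec_eq_iff algebra_simps)
  then have zero: "?A (\<rho> ?v ?w y) = 0" for y
  proof (rule rational_points_dense)
    fix y :: "complex ^ 'n" assume "\<forall>i. y $ i \<in> \<rat>"
    then obtain r where y: "y = (\<chi> i. of_rat (r i))" by (rule rational_vector)
    have coord: "gal_rel \<sigma> (conj_vec l \<theta> $ k) (conj_vec l (\<sigma> \<circ> \<theta>) $ k)"
      if "\<theta> \<in> complex_embeddings" for \<theta> k
      using embedding_in_Qbar[OF K that] by (simp add: conj_vec_def gal_rel_def)
    have dot: "gal_rel \<sigma> (dotp (conj_vec l \<theta>) y) (dotp (conj_vec l (\<sigma> \<circ> \<theta>)) y)"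
      if "\<theta> \<in> complex_embeddings" for \<theta>
      unfolding dotp_def
      by (intro gal_rel_sum[OF \<sigma>] gal_rel_mult[OF \<sigma>] coord that) (simp add: y gal_rel_of_rat[OF \<sigma>])
    have axis: "gal_rel \<sigma> (axis i' 1 $ k) (axis i' 1 $ k)" for i' k :: 'n
      by (simp add: axis_def gal_rel_0[OF \<sigma>] gal_rel_1[OF \<sigma>])
    have "gal_rel \<sigma> (\<rho> (conj_vec l \<phi>) (conj_vec l \<psi>) y $ k) (\<rho> ?v ?w y $ k)" for k
      unfolding \<rho>_def \<Delta>_def vector_minus_component vector_smult_component
      by (intro gal_rel_diff[OF \<sigma>] gal_rel_mult[OF \<sigma>] coord dot axis emb)
        (simp add: y gal_rel_of_rat[OF \<sigma>])
    from gal_rel_mveval[OF \<sigma> this]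
    have "gal_rel \<sigma> (?A (\<rho> (conj_vec l \<phi>) (conj_vec l \<psi>) y)) (?A (\<rho> ?v ?w y))" .
    then show "?A (\<rho> ?v ?w y) = 0"
      unfolding vanish[OF in_plane] using gal_rel_0[OF \<sigma>] by (simp add: gal_rel_def)
  qed
  have "\<rho> ?v ?w (inverse (\<Delta> ?v ?w) *s x) = x"
    using x ij by (simp add: \<rho>_def dotp_scale vec.scale_scale \<Delta>_def)
  with zero show ?thesis by metis
qed

section \<open>Irreducibility\<close>

lemma linear_forms_common_nonzero:
  assumes "finite I" "\<And>i. i \<in> I \<Longrightarrow> \<exists>x. dotp (v i) x \<noteq> 0"
    and "lines_degree_le e q" "\<exists>x. q x \<noteq> 0"
  obtains x where "\<And>i. i \<in> I \<Longrightarrow> dotp (v i) x \<noteq> 0" "q x \<noteq> 0"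
proof -
  define g where "g k = (case k of None \<Rightarrow> q | Some i \<Rightarrow> dotp (v i))" for k
  have "\<exists>x\<in>UNIV. \<forall>k\<in>insert None (Some ` I). g k x \<noteq> 0"
  proof (rule subspace_common_nonzero[OF vec.subspace_UNIV])
    show "finite (insert None (Some ` I))" using assms(1) by simp
    show "\<exists>e. lines_degree_le e (g k)" if "k \<in> insert None (Some ` I)" for k
      using assms(3) lines_degree_le_dotp by (cases k) (auto simp: g_def)
    show "\<exists>x\<in>UNIV. g k x \<noteq> 0" if "k \<in> insert None (Some ` I)" for k
      using assms(2,4) that by (cases k) (auto simp: g_def)
  qed
  then show ?thesis using that by (force simp: g_def)
qed

lemma vanish_on_subspace_factor:
  assumes W: "vec.subspace W" and A: "lines_degree_le a A" and B: "lines_degree_le b B"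
    and "\<And>x. x \<in> W \<Longrightarrow> A x * B x = 0"
  shows "(\<forall>x\<in>W. A x = 0) \<or> (\<forall>x\<in>W. B x = 0)"
proof (rule ccontr)
  assume "\<not> ?thesis"
  then have "\<exists>x\<in>W. \<forall>k\<in>UNIV. (if k then A else B) x \<noteq> 0"
    using A B by (intro subspace_common_nonzero[OF W]) auto
  then obtain x where x: "x \<in> W" "\<And>k. (if k then A else B) x \<noteq> 0" by blast
  from x(2)[of True] x(2)[of False] assms(4)[OF x(1)] show False by simp
qed

text \<open>By \<open>mvpoly_eq_0I\<close> a constant polynomial function comes from a constant polynomial.\<close>
lemma const_mvpoly_unit:
  fixes b :: "('n::finite, 'a::field_char_0) mvpoly"
  assumes "\<And>y. mveval b y = mveval b 0" "b \<noteq> 0"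
  shows "b dvd 1"
proof -
  let ?r = "mveval b 0"
  have "mveval (b + Poly_Mapping.single 0 (- ?r)) y = 0" for y
    using assms(1)[of y] by (simp add: mveval_add mveval_single eval_monom_def)
  then have "b + Poly_Mapping.single 0 (- ?r) = 0"
    by (rule mvpoly_eq_0I)
  then have b: "b = Poly_Mapping.single 0 ?r"
    by (simp add: single_uminus)
  with assms(2) have "?r \<noteq> 0" by auto
  then have "Poly_Mapping.single 0 ?r * Poly_Mapping.single 0 (inverse ?r) = 1"
    by (simp add: mult_single)
  then show ?thesis using b by (metis dvdI)
qed

locale norm_form =
  fixes l :: "('n::finite, 'k::field_char_0) mvpoly" and f :: "('n, rat) mvpoly"
  assumes K: "number_field TYPE('k)" and degree_ge: "4 \<le> number_field_degree TYPE('k)"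
    and dim_ge: "3 \<le> CARD('n)"
    and linear: "form_of_degree 1 l" and gp: "conjugates_in_general_position l"
    and f: "map_coeffs of_rat f = field_norm_form l"
begin

abbreviation E :: "('k \<Rightarrow> complex) set" where "E \<equiv> complex_embeddings"

abbreviation L :: "('k \<Rightarrow> complex) \<Rightarrow> complex ^ 'n \<Rightarrow> complex" where "L \<phi> \<equiv> dotp (conj_vec l \<phi>)"

abbreviation ceval :: "('n, rat) mvpoly \<Rightarrow> complex ^ 'n \<Rightarrow> complex" where
  "ceval a \<equiv> mveval (map_coeffs of_rat a)"

lemma finite_E: "finite E" and card_E: "card E = number_field_degree TYPE('k)"
  by (rule finite_embeddings[OF K], rule card_embeddings[OF K])

lemma ceval_f: "ceval f x = (\<Prod>\<phi>\<in>E. L \<phi> x)"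
  unfolding f field_norm_form_def mveval_prod
  by (rule prod.cong) (simp_all add: mveval_conjugate[OF linear])

lemma form_f: "form_of_degree (number_field_degree TYPE('k)) f"
  using norm_form_degree[OF K linear] unfolding f[symmetric]
  by (rule form_of_degree_map_coeffsD) auto

lemma separate0: "\<phi> \<in> E \<Longrightarrow> \<exists>x. L \<phi> x \<noteq> 0"
  using general_position_separate[OF gp linear, of "{}" \<phi>] by simp

lemma separate1: "\<phi> \<in> E \<Longrightarrow> \<psi> \<in> E \<Longrightarrow> \<phi> \<noteq> \<psi> \<Longrightarrow> \<exists>x. L \<phi> x = 0 \<and> L \<psi> x \<noteq> 0"
  using general_position_separate[OF gp linear, of "{\<phi>}" \<psi>] dim_ge by simp

lemma separate2: "\<phi> \<in> E \<Longrightarrow> \<psi> \<in> E \<Longrightarrow> \<theta> \<in> E \<Longrightarrow> \<phi> \<noteq> \<psi> \<Longrightarrow> \<theta> \<noteq> \<phi> \<Longrightarrow> \<theta> \<noteq> \<psi> \<Longrightarrow>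
    \<exists>x. L \<phi> x = 0 \<and> L \<psi> x = 0 \<and> L \<theta> x \<noteq> 0"
  using general_position_separate[OF gp linear, of "{\<phi>, \<psi>}" \<theta>] dim_ge by simp

lemma conj_vec_nonzero: "\<phi> \<in> E \<Longrightarrow> conj_vec l \<phi> \<noteq> 0"
  using separate0[of \<phi>] by (auto simp: dotp_def)

lemma f_nonzero: "f \<noteq> 0"
proof
  assume "f = 0"
  obtain x where "\<And>\<phi>. \<phi> \<in> E \<Longrightarrow> L \<phi> x \<noteq> 0"
    using linear_forms_common_nonzero[of E "conj_vec l" 0 "\<lambda>_. 1"] finite_E separate0
    by (metis lines_degree_le_const zero_neq_one)
  then have "ceval f x \<noteq> 0"
    unfolding ceval_f using finite_E by simp
  with \<open>f = 0\<close> show False by simp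
qed

lemma lines_degree_f: "lines_degree_le (number_field_degree TYPE('k)) (ceval f)"
proof (rule lines_degree_le_mveval)
  fix m assume "m \<in> Poly_Mapping.keys (map_coeffs complex_of_rat f)"
  then show "monom_degree m \<le> number_field_degree TYPE('k)"
    using form_f by (simp add: form_of_degree_def in_keys_iff lookup_map_coeffs)
qed

text \<open>If \<open>b\<close> is not constant, a general line satisfies three requirements at once: \<open>f\<close> is not identically
zero on it, \<open>b\<close> is not constant on it, and it meets the \<open>d\<close> hyperplanes in distinct points. All these points are
zeros of \<open>a\<close>, so \<open>a\<close> uses up the whole degree of \<open>f\<close> on the line.\<close>
lemma cofactor_const:
  assumes fab: "f = a * b" and \<phi>: "\<phi> \<in> E" and vanish: "\<And>x. L \<phi> x = 0 \<Longrightarrow> ceval a x = 0"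
  shows "b dvd 1"
proof -
  interpret rat: ring_morphism "of_rat :: rat \<Rightarrow> complex" by (rule ring_morphism_of_rat)
  have AB: "ceval f x = ceval a x * ceval b x" for x
    by (simp add: fab rat.map_coeffs_mult mveval_mult)
  have A: "ceval a x = 0" if "\<psi> \<in> E" "L \<psi> x = 0" for \<psi> x
    using vanish_on_conjugate_hyperplane[OF \<phi> that(1) conj_vec_nonzero[OF \<phi>] vanish that(2)] .
  obtain e where e: "lines_degree_le e (ceval b)" using lines_degree_le_mveval_ex by blast
  have const: "ceval b x = ceval b 0" for x
  proof (rule ccontr)
    assume "ceval b x \<noteq> ceval b 0"
    then have "\<exists>x. ceval b x - ceval b 0 \<noteq> 0" by auto
    then obtain x where x: "\<And>\<psi>. \<psi> \<in> E \<Longrightarrow> L \<psi> x \<noteq> 0" "ceval b x - ceval b 0 \<noteq> 0"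
      using linear_forms_common_nonzero[where v = "conj_vec l" and q = "\<lambda>x. ceval b x - ceval b 0",
          OF finite_E separate0 lines_degree_le_diff[OF e lines_degree_le_const]] by blast
    \<comment> \<open>The direction \<open>- x\<close> shows that \<open>b\<close> is nonconstant on some line through \<open>x\<close>.\<close>
    have "lines_degree_le e (\<lambda>y. ceval b (x + y) - ceval b x)"
      by (intro lines_degree_le_diff lines_degree_le_const
          lines_degree_le_compose[OF e, where L' = "\<lambda>y. y"]) (simp add: add.assoc)
    moreover have "\<exists>y\<in>UNIV. ceval b (x + y) - ceval b x \<noteq> 0"
      using x(2) by (intro bexI[of _ "- x"]) auto
    ultimately obtain y where y: "\<And>\<psi>. \<psi> \<in> E \<Longrightarrow> L \<psi> y \<noteq> 0"
        "inj_on (\<lambda>\<psi>. - L \<psi> x / L \<psi> y) E" "ceval b (x + y) - ceval b x \<noteq> 0"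
      by (rule line_meeting_hyperplanes[OF vec.subspace_UNIV finite_E, of "conj_vec l" x, rotated 3])
        (use card_E degree_ge separate1 x(1) in auto)
    obtain pa where pa: "\<And>t. ceval a (x + t *s y) = poly pa t"
      using lines_degree_le_mveval_ex unfolding lines_degree_le_def by metis
    obtain pb where pb: "\<And>t. ceval b (x + t *s y) = poly pb t"
      using e unfolding lines_degree_le_def by metis
    obtain pf where pf: "degree pf \<le> card E" "\<And>t. ceval f (x + t *s y) = poly pf t"
      using lines_degree_f unfolding lines_degree_le_def card_E by metis
    have "poly (pa * pb) t = poly pf t" for t
      using AB[of "x + t *s y"] pa[of t] pb[of t] pf(2)[of t] by simp
    then have eq: "pa * pb = pf"
      by (intro poly_eq_poly_eq_iff[THEN iffD1] ext) 
    have "ceval f x \<noteq> 0"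
      unfolding ceval_f using finite_E x(1) by simp
    then have "pf \<noteq> 0"
      using pf(2)[of 0] by auto
    then have nz: "pa \<noteq> 0" "pb \<noteq> 0" using eq by auto
    have "poly pa (- L \<psi> x / L \<psi> y) = 0" if "\<psi> \<in> E" for \<psi>
      unfolding pa[symmetric] using that y(1)[OF that]
      by (intro A[OF that]) (simp add: dotp_add dotp_diff dotp_scale)
    then have "(\<lambda>\<psi>. - L \<psi> x / L \<psi> y) ` E \<subseteq> {t. poly pa t = 0}" by blast
    then have "card E \<le> card {t. poly pa t = 0}"
      using card_mono[OF poly_roots_finite[OF nz(1)]] card_image[OF y(2)] by metis
    also have "\<dots> \<le> degree pa"
      by (rule card_poly_roots_bound[OF nz(1)])
    finally have "degree pb = 0"
      using pf(1) degree_mult_eq[OF nz] eq by simp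
    then have "poly pb 1 = poly pb 0"
      by (auto elim: degree_eq_zeroE)
    with pb[of 1] pb[of 0] y(3) show False by simp
  qed
  have "mveval b y = mveval b 0" for y
  proof -
    have "complex_of_rat (mveval b y) = of_rat (mveval b 0)"
      using const[of "\<chi> i. of_rat (y $ i)"] mveval_of_rat_point[of b y, where 'k = complex]
        mveval_of_rat_point[of b 0, where 'k = complex]
      by (simp add: zero_vec_def)
    then show ?thesis by simp
  qed
  moreover have "b \<noteq> 0" using fab f_nonzero by auto
  ultimately show ?thesis by (rule const_mvpoly_unit)
qed

lemma irreducible_f: "irreducible f"
proof (rule irreducibleI[OF f_nonzero])
  interpret rat: ring_morphism "of_rat :: rat \<Rightarrow> complex" by (rule ring_morphism_of_rat)
  show "\<not> f dvd 1"
  proof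
    assume "f dvd 1"
    then obtain g where "1 = f * g" by blast
    then have "1 = ceval f 0 * ceval g 0"
      by (metis mveval_mult mveval_one rat.map_coeffs_mult ring_morphism.hom_one rat.ring_morphism_map_coeffs)
    moreover have "0 < card E" using card_E degree_ge by simp
    ultimately show False
      by (simp add: ceval_f power_0_left)
  qed
next
  interpret rat: ring_morphism "of_rat :: rat \<Rightarrow> complex" by (rule ring_morphism_of_rat)
  fix a b assume fab: "f = a * b"
  obtain \<phi> where \<phi>: "\<phi> \<in> E" using card_E degree_ge by fastforce
  obtain i j where "lines_degree_le i (ceval a)" "lines_degree_le j (ceval b)"
    using lines_degree_le_mveval_ex by blast
  moreover have "ceval a x * ceval b x = 0" if "L \<phi> x = 0" for x
  proof -
    have "ceval a x * ceval b x = ceval f x"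
      by (simp add: fab rat.map_coeffs_mult mveval_mult)
    also have "\<dots> = 0"
      unfolding ceval_f using that \<phi> finite_E by auto
    finally show ?thesis .
  qed
  ultimately consider "\<And>x. L \<phi> x = 0 \<Longrightarrow> ceval a x = 0" | "\<And>x. L \<phi> x = 0 \<Longrightarrow> ceval b x = 0"
    using vanish_on_subspace_factor[OF subspace_dotp[of "{conj_vec l \<phi>}"]] by fastforce
  then show "a dvd 1 \<or> b dvd 1"
  proof cases
    case 1
    then show ?thesis using cofactor_const[OF fab \<phi>] by blast
  next
    case 2
    then show ?thesis using cofactor_const[of b a, OF _ \<phi>] fab by (simp add: mult.commute)
  qed
qed

end

section \<open>No representation as a sum of squares over the rationals\<close>

text \<open>The coefficients of the highest degree \<open>D\<close> among the \<open>p i\<close> cannot cancel, since their squares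
are nonnegative.\<close>
lemma degree_le_of_sum_of_squares:
  fixes p :: "nat \<Rightarrow> rat poly"
  assumes "i < k"
  shows "2 * degree (p i) \<le> degree (\<Sum>i<k. (p i)\<^sup>2)"
proof (cases "degree (p i) = 0")
  case False
  define D where "D = Max (degree ` p ` {..<k})"
  have D: "degree (p j) \<le> D" if "j < k" for j
    using that by (simp add: D_def)
  have "D \<in> degree ` p ` {..<k}"
    unfolding D_def using assms by (intro Max_in) auto
  then obtain j where j: "j < k" "degree (p j) = D" by auto
  have sq: "coeff ((p j)\<^sup>2) (2 * D) = (coeff (p j) D)\<^sup>2" if "j < k" for j
  proof (cases "degree (p j) = D")
    case True
    then show ?thesis
      using coeff_mult_degree_sum[of "p j" "p j"] by (simp add: power2_eq_square mult_2)
  next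
    case False
    then have "degree (p j) < D" using D[OF that] by simp
    moreover have "degree ((p j)\<^sup>2) \<le> degree (p j) + degree (p j)"
      unfolding power2_eq_square by (rule degree_mult_le)
    ultimately show ?thesis by (simp add: coeff_eq_0)
  qed
  have "coeff (\<Sum>i<k. (p i)\<^sup>2) (2 * D) = (\<Sum>i<k. (coeff (p i) D)\<^sup>2)"
    by (simp add: coeff_sum sq)
  moreover have "p j \<noteq> 0"
    using D[OF assms] j(2) False by auto
  then have "coeff (p j) D \<noteq> 0" using j(2) by (metis leading_coeff_0_iff)
  then have "0 < (\<Sum>i<k. (coeff (p i) D)\<^sup>2)"
    using j(1) by (intro sum_pos2[of _ j]) auto
  ultimately have "2 * D \<le> degree (\<Sum>i<k. (p i)\<^sup>2)"
    by (intro le_degree) auto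
  with D[OF assms] show ?thesis by linarith
qed simp

text \<open>Along the ray through a rational point \<open>x\<close> the coefficient of \<open>t\<^sup>e\<close> is the value at \<open>x\<close> of the
homogeneous part of degree \<open>e\<close>. By the one-variable bound it is zero for every \<open>x\<close> if \<open>2 e > d\<close>.\<close>
lemma monom_degree_le_of_sum_of_squares:
  fixes f :: "('n::finite, rat) mvpoly" and h :: "nat \<Rightarrow> ('n, rat) mvpoly"
  assumes form: "form_of_degree d f" and f: "f = (\<Sum>i<k. (h i)\<^sup>2)"
    and "i < k" and m: "m \<in> Poly_Mapping.keys (h i)"
  shows "2 * monom_degree m \<le> d"
proof (rule ccontr)
  assume *: "\<not> ?thesis"
  let ?e = "monom_degree m"
  define ray where "ray q x = (\<Sum>m\<in>Poly_Mapping.keys q.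
      monom (Poly_Mapping.lookup q m * eval_monom m x) (monom_degree m))"
    for q :: "('n, rat) mvpoly" and x
  have poly_ray: "poly (ray q x) t = mveval q (t *s x)" for q x t
  proof -
    have "eval_monom m (t *s x) = eval_monom m x * t ^ monom_degree m" for m :: "'n \<Rightarrow>\<^sub>0 nat"
      by (simp add: eval_monom_def power_mult_distrib prod.distrib monom_degree_alt power_sum
          mult.commute)
    then show ?thesis
      by (simp add: ray_def poly_sum poly_monom mveval_superset[OF finite_keys order_refl] mult.assoc)
  qed
  have "degree (ray f x) \<le> d" for x
    unfolding ray_def using form
    by (intro degree_sum_le) (auto simp: form_of_degree_def intro: order_trans[OF degree_monom_le])
  moreover have "ray f x = (\<Sum>i<k. (ray (h i) x)\<^sup>2)" for x
    by (intro poly_eq_poly_eq_iff[THEN iffD1] ext)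
      (simp add: poly_ray poly_sum mveval_sum mveval_power f)
  ultimately have "2 * degree (ray (h i) x) \<le> d" for x
    using degree_le_of_sum_of_squares[OF \<open>i < k\<close>] by (metis le_trans)
  then have "coeff (ray (h i) x) ?e = 0" for x
    using * by (intro coeff_eq_0) (meson not_le_imp_less le_trans mult_le_mono2)
  moreover
  define top where "top = (\<Sum>m\<in>{m\<in>Poly_Mapping.keys (h i). monom_degree m = ?e}.
      Poly_Mapping.single m (Poly_Mapping.lookup (h i) m))"
  have "coeff (ray (h i) x) ?e = mveval top x" for x
    unfolding ray_def top_def coeff_sum mveval_sum mveval_single coeff_monom
    by (intro sum.mono_neutral_cong_right) auto
  ultimately have "top = 0"
    by (intro mvpoly_eq_0I) simp
  moreover have "Poly_Mapping.lookup top m = Poly_Mapping.lookup (h i) m"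
    unfolding top_def lookup_sum lookup_single when_def
    using m by (subst sum.delta) auto
  ultimately show False using m by (simp add: in_keys_iff)
qed

lemma mveval_real_point:
  fixes x :: "complex ^ 'n::finite"
  assumes "\<And>i. x $ i \<in> \<real>"
  shows "mveval (map_coeffs of_rat h) x \<in> \<real>"
proof -
  have "of_real \<in> complex_embeddings"
    by (simp add: complex_embeddings_def)
  from embedding_of_rat[OF this] have "complex_of_rat r \<in> \<real>" for r
    by (metis Reals_of_real)
  then show ?thesis
    unfolding mveval_def using assms
    by (intro sum_in_Reals Reals_mult prod_in_Reals Reals_power) (simp_all add: lookup_map_coeffs)
qed

context norm_form
begin

text \<open>The plane is stable under conjugation, so it contains the real part \<open>u\<close> and the imaginary part \<open>w\<close>
of \<open>x\<close>. At the real points \<open>u + t w\<close> the squares are nonnegative real numbers with sum \<open>f = 0\<close>. A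
polynomial in \<open>t\<close> with all real numbers as zeros is also zero at \<open>t = \<i>\<close>.\<close>
lemma squares_vanish_on_conjugate_plane:
  fixes h :: "nat \<Rightarrow> ('n, rat) mvpoly"
  assumes sos: "f = (\<Sum>i<k. (h i)\<^sup>2)" and "i < k" and \<phi>: "\<phi> \<in> E"
    and x: "L \<phi> x = 0" "L (cnj \<circ> \<phi>) x = 0"
  shows "ceval (h i) x = 0"
proof -
  interpret rat: ring_morphism "map_coeffs of_rat :: ('n, rat) mvpoly \<Rightarrow> ('n, complex) mvpoly"
    by (rule ring_morphism.ring_morphism_map_coeffs[OF ring_morphism_of_rat])
  have real: "ceval (h i) u = 0" if u: "\<And>j. u $ j \<in> \<real>" "L \<phi> u = 0" for u
  proof -
    have "(\<Sum>i<k. (ceval (h i) u)\<^sup>2) = ceval f u"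
      unfolding sos by (simp add: rat.hom_sum rat.hom_power mveval_sum mveval_power)
    also have "\<dots> = 0"
      unfolding ceval_f using u(2) \<phi> finite_E by auto
    finally have "(\<Sum>i<k. (ceval (h i) u)\<^sup>2) = 0" .
    moreover have H: "ceval (h i) u = of_real (Re (ceval (h i) u))" for i
      using mveval_real_point[of u "h i"] u(1) by (simp add: of_real_Re)
    ultimately have "complex_of_real (\<Sum>i<k. (Re (ceval (h i) u))\<^sup>2) = 0"
      by (simp only: of_real_sum of_real_power H[symmetric])
    then have "(\<Sum>i<k. (Re (ceval (h i) u))\<^sup>2) = 0"
      by (simp only: of_real_eq_0_iff)
    then have "Re (ceval (h i) u) = 0"
      using \<open>i < k\<close> by (subst (asm) sum_nonneg_eq_0_iff) auto
    with H[of i] show ?thesis by simp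
  qed
  define u w where "u = (\<chi> j. complex_of_real (Re (x $ j)))" and "w = (\<chi> j. complex_of_real (Im (x $ j)))"
  have x_eq: "x = u + \<i> *s w"
    by (simp add: vec_eq_iff u_def w_def complex_eq)
  have bar: "u - \<i> *s w = (\<chi> j. cnj (x $ j))"
    by (simp add: vec_eq_iff u_def w_def complex_eq_iff)
  have "L \<phi> (\<chi> j. cnj (x $ j)) = cnj (L (cnj \<circ> \<phi>) x)"
    by (simp add: dotp_def conj_vec_def)
  then have "L \<phi> (u - \<i> *s w) = 0"
    using x(2) by (simp add: bar)
  then have "L \<phi> u = 0" "L \<phi> w = 0"
    using x(1) unfolding x_eq dotp_add dotp_diff dotp_scale by auto
  then have vanish: "ceval (h i) (u + complex_of_real t *s w) = 0" for t
    by (intro real) (auto simp: dotp_add dotp_scale u_def w_def)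
  obtain p where p: "\<And>t. ceval (h i) (u + t *s w) = poly p t"
    using lines_degree_le_mveval_ex unfolding lines_degree_le_def by metis
  have "range complex_of_real \<subseteq> {t. poly p t = 0}"
    using vanish p by auto
  moreover have "infinite (range complex_of_real)"
    by (simp add: finite_image_iff inj_on_def infinite_UNIV_char_0)
  ultimately have "infinite {t. poly p t = 0}"
    using finite_subset by blast
  then have "p = 0" using poly_roots_finite by blast
  then show ?thesis using p[of \<i>] x_eq by simp
qed

text \<open>Each square root is zero on all \<open>H\<^sub>\<phi> \<inter> H\<^sub>\<psi>\<close>, then on all \<open>H\<^sub>\<phi>\<close>, then everywhere; the last two steps
count zeros against the bound \<open>d div 2\<close> on the degree, which is less than \<open>d - 1\<close> because \<open>d \<ge> 4\<close>.\<close>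
lemma not_sum_of_squares:
  assumes imag: "totally_imaginary TYPE('k)"
    and trans: "two_transitive Gal_Qbar (\<lambda>\<sigma> \<phi>. \<sigma> \<circ> \<phi>) E"
  shows "\<not> sum_of_squares k f"
proof
  assume "sum_of_squares k f"
  then obtain h where sos: "f = (\<Sum>i<k. (h i)\<^sup>2)"
    unfolding sum_of_squares_def by blast
  let ?e = "number_field_degree TYPE('k) div 2"
  have "ceval (h i) x = 0" if "i < k" for i x
  proof -
    let ?H = "ceval (h i)"
    have deg: "lines_degree_le ?e ?H"
    proof (rule lines_degree_le_mveval)
      fix m assume "m \<in> Poly_Mapping.keys (map_coeffs complex_of_rat (h i))"
      then have "m \<in> Poly_Mapping.keys (h i)"
        by (simp add: in_keys_iff lookup_map_coeffs)
      from monom_degree_le_of_sum_of_squares[OF form_f sos that this]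
      show "monom_degree m \<le> ?e" by simp
    qed
    obtain \<phi>0 where \<phi>0: "\<phi>0 \<in> E" using card_E degree_ge by fastforce
    \<comment> \<open>2-transitivity moves the pair \<open>\<phi>0\<close>, \<open>cnj \<circ> \<phi>0\<close> to any other pair.\<close>
    have plane: "?H x = 0" if pair: "\<phi> \<in> E" "\<psi> \<in> E" "\<phi> \<noteq> \<psi>" "L \<phi> x = 0" "L \<psi> x = 0" for \<phi> \<psi> x
    proof -
      have "cnj \<circ> \<phi>0 \<noteq> \<phi>0" "cnj \<circ> \<phi>0 \<in> E"
        using cnj_embedding_neq[OF imag \<phi>0] cnj_embedding[OF \<phi>0] by auto
      then obtain \<sigma> where \<sigma>: "\<sigma> \<in> Gal_Qbar" "\<sigma> \<circ> \<phi>0 = \<phi>" "\<sigma> \<circ> (cnj \<circ> \<phi>0) = \<psi>"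
        using trans pair(1-3) \<phi>0 unfolding two_transitive_def by metis
      show ?thesis
      proof (rule vanish_on_conjugate_pair[OF K \<sigma>(1) \<phi>0 cnj_embedding[OF \<phi>0]])
        show "?H x = 0" if "L \<phi>0 x = 0" "L (cnj \<circ> \<phi>0) x = 0" for x
          by (rule squares_vanish_on_conjugate_plane[OF sos \<open>i < k\<close> \<phi>0 that])
      qed (use \<sigma>(2,3) pair separate1 conj_vec_nonzero in auto)
    qed
    have hyperplane: "?H x = 0" if \<phi>: "\<phi> \<in> E" and x: "L \<phi> x = 0" for \<phi> x
    proof (rule vanish_on_many_hyperplanes[OF subspace_dotp[of "{conj_vec l \<phi>}"], where
          I = "E - {\<phi>}" and v = "conj_vec l" and e = ?e])
      show "2 \<le> card (E - {\<phi>})" "?e < card (E - {\<phi>})"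
        using card_E degree_ge finite_E \<phi> by auto
      show "\<exists>y\<in>{x. \<forall>v\<in>{conj_vec l \<phi>}. dotp v x = 0}. L \<psi> y = 0 \<and> L \<theta> y \<noteq> 0"
        if "\<psi> \<in> E - {\<phi>}" "\<theta> \<in> E - {\<phi>}" "\<psi> \<noteq> \<theta>" for \<psi> \<theta>
        using separate2[OF \<phi>, of \<psi> \<theta>] that by auto
      show "?H x = 0" if "\<psi> \<in> E - {\<phi>}" "x \<in> {x. \<forall>v\<in>{conj_vec l \<phi>}. dotp v x = 0}" "L \<psi> x = 0" for \<psi> x
        using plane[OF \<phi>, of \<psi> x] that by auto
    qed (use deg x finite_E in auto)
    show "?H x = 0"
    proof (rule vanish_on_many_hyperplanes[OF vec.subspace_UNIV, where
          I = E and v = "conj_vec l" and e = ?e])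
      show "2 \<le> card E" "?e < card E"
        using card_E degree_ge by auto
    qed (use deg finite_E hyperplane separate1 in auto)
  qed
  then have "ceval f x = 0" for x
  proof -
    interpret rat: ring_morphism "map_coeffs of_rat :: ('n, rat) mvpoly \<Rightarrow> ('n, complex) mvpoly"
      by (rule ring_morphism.ring_morphism_map_coeffs[OF ring_morphism_of_rat])
    show ?thesis
      unfolding sos using \<open>\<And>x i. i < k \<Longrightarrow> ceval (h i) x = 0\<close>
      by (simp add: rat.hom_sum rat.hom_power mveval_sum mveval_power)
  qed
  then have "map_coeffs complex_of_rat f = 0"
    by (intro mvpoly_eq_0I)
  then have "f = 0"
    unfolding poly_mapping_eq_iff fun_eq_iff by (simp add: lookup_map_coeffs)
  then show False using f_nonzero by contradiction
qed

end

theorem theorem2p6: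
  fixes n d :: nat
    and l :: "('n::finite, 'k::field_char_0) mvpoly"
  assumes "n \<ge> 2" and "CARD('n) = n + 1"
    and "number_field TYPE('k)"
    and "number_field_degree TYPE('k) = d" and "d \<ge> 4"
    and "totally_imaginary TYPE('k)"
    and "form_of_degree 1 l"
    and "conjugates_in_general_position l"
    and "two_transitive Gal_Qbar (\<lambda>\<sigma> \<phi>. \<sigma> \<circ> \<phi>) (complex_embeddings :: ('k \<Rightarrow> complex) set)"
  shows "\<exists>f :: ('n, rat) mvpoly.
           map_coeffs of_rat f = field_norm_form l \<and>
           form_of_degree d f \<and>
           irreducible f \<and>
           sum_of_squares 2 (map_coeffs of_rat f :: ('n, real) mvpoly) \<and>
           (\<forall>k. \<not> sum_of_squares k f)"
proof -
  obtain f :: "('n, rat) mvpoly" where f: "map_coeffs of_rat f = field_norm_form l"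
    using norm_form_rational[OF assms(3), of l] by auto
  interpret norm_form l f
    using assms f by unfold_locales auto
  show ?thesis
    using f form_f irreducible_f norm_form_sum_of_two_squares[OF assms(3,6) f]
      not_sum_of_squares[OF assms(6,9)] assms(4) by blast
qed

end
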